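(* Let $K$ be a number field, $\ell$ a prime number, and $G$ a torsion-free subgroup of $K^\times$ of finite rank $r>0$. Then there are nonnegative integers $d_1,\ldots,d_r,h_1,\ldots,h_r$ such that $G=\langle B_1^{\ell^{d_1}}\zeta_1,\ldots,B_r^{\ell^{d_r}}\zeta_r\rangle$ for some strongly $\ell$-independent elements $B_1,\ldots,B_r$ of $K^\times$ and some roots of unity $\zeta_i\in K$ of order $\ell^{h_i}$.
   Context: An element $a\in K^\times$ is strongly $\ell$-indivisible if there is no root of unity $\zeta\in K$ of $\ell$-power order with $a\zeta\in(K^\times)^\ell=\{x^\ell:x\in K^\times\}$. Elements $a_1,\ldots,a_r\in K^\times$ are strongly $\ell$-independent if $a_1^{x_1}\cdots a_r^{x_r}$ is strongly $\ell$-indivisible whenever $x_1,\ldots,x_r$ are integers not all divisible by $\ell$. *)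

theory Defs
  imports
    "HOL-Computational_Algebra.Primes"
    "HOL-Algebra.Generated_Groups"
    "HOL-Algebra.Multiplicative_Group"
    "HOL-Algebra.Algebraic_Closure_Type"
    "HOL-Library.Extended_Nat"
begin

definition number_field :: "'a::field_char_0 itself \<Rightarrow> bool"
  where "number_field (_ :: 'a itself) \<longleftrightarrow>
    (\<exists>B. finite_dimensional_vector_space (\<lambda>(q::rat) (x::'a). of_rat q * x) B)"

lemma number_field_rat: "number_field TYPE(rat)"
proof -
  have "finite_dimensional_vector_space (\<lambda>(q::rat) x. (of_rat q :: rat) * x) {1}"
  proof -
    interpret V: vector_space "\<lambda>(q::rat) x. (of_rat q :: rat) * x"
      by unfold_locales (simp_all add: algebra_simps of_rat_add of_rat_mult)
    have "x \<in> V.span {1}" for x :: rat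
      using V.span_scale[OF V.span_base[of 1 "{1}"], of x] by simp
    then have "V.span {1} = UNIV"
      by auto
    moreover have "V.independent {1}"
      using V.dependent_single by simp
    ultimately show ?thesis
      by unfold_locales simp_all
  qed
  then show ?thesis
    unfolding number_field_def by blast
qed

abbreviation unit_group :: "'a::field monoid"
  where "unit_group \<equiv> Multiplicative_Group.mult_of ring_of_type_algebra"

lemma unit_group_simps:
  "carrier (unit_group :: 'a::field monoid) = UNIV - {0}"
  "x \<otimes>\<^bsub>unit_group\<^esub> y = x * (y::'a)"
  "\<one>\<^bsub>unit_group\<^esub> = (1::'a)"
  by (simp_all add: ring_of_type_algebra_def)

lemma unit_group_pow: "x [^]\<^bsub>unit_group\<^esub> n = (x::'a::field) ^ (n::nat)"
  by (induction n) (simp_all add: nat_pow_def ring_of_type_algebra_def mult.commute)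

lemma group_unit_group: "group (unit_group :: 'a::field monoid)"
  using field.field_mult_group[OF field_from_type_algebra] .

(* The order of an element; it is 0 for elements of infinite order. *)
abbreviation unit_ord :: "'a::field \<Rightarrow> nat"
  where "unit_ord \<equiv> group.ord unit_group"

definition torsion_free :: "'a::field set \<Rightarrow> bool"
  where "torsion_free G \<longleftrightarrow> (\<forall>g\<in>G. \<forall>n::nat. n > 0 \<and> g ^ n = 1 \<longrightarrow> g = 1)"

definition mult_independent :: "nat \<Rightarrow> (nat \<Rightarrow> 'a::field) \<Rightarrow> bool"
  where "mult_independent n g \<longleftrightarrow>
    (\<forall>x :: nat \<Rightarrow> int. (\<Prod>i<n. g i powi x i) = 1 \<longrightarrow> (\<forall>i<n. x i = 0))"

(* The rank of an abelian group: the dimension of its tensor product with the rationals, i.e. the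
   supremum of the lengths of families in it that are linearly independent over the integers. *)
definition mult_rank :: "'a::field set \<Rightarrow> enat"
  where "mult_rank G = Sup {enat n | n. \<exists>g. (\<forall>i<n. g i \<in> G) \<and> mult_independent n g}"

definition strongly_indivisible :: "nat \<Rightarrow> 'a::field \<Rightarrow> bool"
  where "strongly_indivisible l a \<longleftrightarrow> a \<noteq> 0 \<and>
    \<not> (\<exists>\<zeta>. \<zeta> \<noteq> 0 \<and> (\<exists>k. unit_ord \<zeta> = l ^ k) \<and> a * \<zeta> \<in> {x ^ l | x. x \<noteq> 0})"

definition strongly_independent :: "nat \<Rightarrow> nat \<Rightarrow> (nat \<Rightarrow> 'a::field) \<Rightarrow> bool"
  where "strongly_independent l r a \<longleftrightarrow> (\<forall>i<r. a i \<noteq> 0) \<and>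
    (\<forall>x :: nat \<Rightarrow> int. \<not> (\<forall>i<r. int l dvd x i) \<longrightarrow>
      strongly_indivisible l (\<Prod>i<r. a i powi x i))"

end

(*
  Let g_1, ..., g_r be independent in G. If y^n lies in <g_1, ..., g_r>, then up to an element of that
  group y^n is a product of powers g_i^(b_i) with 0 <= b_i < n. For a fixed integer D clearing
  denominators of the g_i, the number D y is an algebraic integer of degree at most [K:Q] whose
  conjugates are bounded independently of n, so only finitely many such y exist. Hence every ascending
  chain of groups between <g_1, ..., g_r> and the group of all its radicals in K becomes stationary.

  Two such chains give the theorem, both built by the same exchange: if y^q = t * prod B_i^(x_i) with q
  prime, t a root of unity and x_i prime to q, then (after normalising x_i = 1) y may replace B_i, and
  the group generated by the B_i and the roots of unity strictly grows. The first chain makes the g_i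
  generate G. The second keeps G generated by the B_i^(l^(d_i)) zeta_i: a failure of strong independence
  yields such a relation with q = l, and replacing B_i for an index i with maximal d_i among those with
  l not dividing x_i turns d_i into d_i + 1 by a unimodular change of generators of G.
*)
theory Submission
  imports Defs "Jordan_Normal_Form.Char_Poly"
begin

section \<open>Integral spans and algebraic integers\<close>

lemma common_denominator:
  "finite (S :: rat set) \<Longrightarrow> \<exists>N>0. \<forall>q\<in>S. \<exists>k. of_int N * q = of_int k"
proof (induction rule: finite_induct)
  case (insert q S)
  then obtain N where N: "N > 0" "\<forall>q\<in>S. \<exists>k. of_int N * q = of_int k" by auto
  obtain a b where q: "quotient_of q = (a, b)" by force
  have b: "b > 0" using quotient_of_denom_pos[OF q] .
  have "of_int b * q = of_int a"
    using b by (subst quotient_of_div[OF q]) (simp add: field_simps)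
  then have "of_int (N * b) * q = of_int (N * a)" by (metis of_int_mult mult.assoc)
  moreover have "\<exists>k. of_int (N * b) * p = of_int k" if p: "p \<in> S" for p
  proof -
    obtain k where k: "of_int N * p = of_int k" using N(2) p by blast
    have "of_int (N * b) * p = of_int b * (of_int N * p)" by (simp add: ac_simps)
    then have "of_int (N * b) * p = of_int (b * k)" unfolding k by simp
    then show ?thesis ..
  qed
  ultimately have "\<forall>p\<in>insert q S. \<exists>k. of_int (N * b) * p = of_int k" by blast
  then show ?case using N b by (intro exI[of _ "N * b"] conjI) simp_all
qed (auto intro: exI[of _ 1])

definition int_span :: "(nat \<Rightarrow> 'a::comm_ring_1) \<Rightarrow> nat \<Rightarrow> 'a set"
  where "int_span e d = range (\<lambda>a. \<Sum>j<d. of_int (a j) * e j)"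

text \<open>The multiplier ring of the lattice \<open>int_span e d\<close>; once some
  \<open>e i\<close> is nonzero, its elements are algebraic integers. Integrality is tested through
  this ring because closure under products is immediate.\<close>

definition multiplier :: "(nat \<Rightarrow> 'a::comm_ring_1) \<Rightarrow> nat \<Rightarrow> 'a \<Rightarrow> bool"
  where "multiplier e d w \<longleftrightarrow> (\<forall>i<d. w * e i \<in> int_span e d)"

lemma int_spanI: "(\<Sum>j<d. of_int (a j) * e j) \<in> int_span e d"
  by (simp add: int_span_def)

lemma int_span_add: "x \<in> int_span e d \<Longrightarrow> y \<in> int_span e d \<Longrightarrow> x + y \<in> int_span e d"
proof -
  assume "x \<in> int_span e d" "y \<in> int_span e d"
  then obtain a b where "x = (\<Sum>j<d. of_int (a j) * e j)" "y = (\<Sum>j<d. of_int (b j) * e j)"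
    by (auto simp: int_span_def)
  then show ?thesis
    using int_spanI[of "\<lambda>j. a j + b j" e d] by (simp add: sum.distrib algebra_simps)
qed

lemma int_span_scale: "x \<in> int_span e d \<Longrightarrow> of_int k * x \<in> int_span e d"
proof -
  assume "x \<in> int_span e d"
  then obtain a where "x = (\<Sum>j<d. of_int (a j) * e j)" by (auto simp: int_span_def)
  then show ?thesis
    using int_spanI[of "\<lambda>j. k * a j" e d] by (simp add: sum_distrib_left mult.assoc)
qed

lemma int_span_sum: "(\<And>i. i \<in> A \<Longrightarrow> f i \<in> int_span e d) \<Longrightarrow> sum f A \<in> int_span e d"
proof (induction A rule: infinite_finite_induct)
  case empty
  then show ?case using int_spanI[of "\<lambda>j. 0" e d] by simp
next
  case (infinite A)
  then show ?case using int_spanI[of "\<lambda>j. 0" e d] by simp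
qed (auto intro: int_span_add)

lemma int_span_base: "i < d \<Longrightarrow> e i \<in> int_span e d"
proof -
  assume "i < d"
  have "(\<Sum>j<d. of_int ((\<lambda>j. if j = i then 1 else 0) j) * e j) = (\<Sum>j<d. if j = i then e j else 0)"
    by (intro sum.cong) auto
  also have "\<dots> = e i" using \<open>i < d\<close> by simp
  finally show ?thesis using int_spanI[of "\<lambda>j. if j = i then 1 else 0" e d] by simp
qed

lemma multiplier_of_int: "multiplier e d (of_int k)"
  unfolding multiplier_def by (auto intro: int_span_scale int_span_base)

lemma multiplier_int_span:
  assumes "multiplier e d w" "x \<in> int_span e d" shows "w * x \<in> int_span e d"
proof -
  obtain a where "x = (\<Sum>j<d. of_int (a j) * e j)" using assms by (auto simp: int_span_def)
  then have "w * x = (\<Sum>j<d. of_int (a j) * (w * e j))" by (simp add: sum_distrib_left ac_simps)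
  also have "\<dots> \<in> int_span e d"
    using assms(1) by (intro int_span_sum int_span_scale) (simp add: multiplier_def)
  finally show ?thesis .
qed

lemma multiplier_mult: "multiplier e d v \<Longrightarrow> multiplier e d w \<Longrightarrow> multiplier e d (v * w)"
  unfolding multiplier_def[of e d "v * w"]
  by (auto simp: mult.assoc multiplier_def[of e d w] intro: multiplier_int_span)

lemma multiplier_power: "multiplier e d v \<Longrightarrow> multiplier e d (v ^ n)"
  using multiplier_of_int[of e d 1] by (induction n) (auto intro: multiplier_mult)

lemma multiplier_prod: "(\<And>i. i \<in> A \<Longrightarrow> multiplier e d (f i)) \<Longrightarrow> multiplier e d (prod f A)"
  using multiplier_of_int[of e d 1]
    by (induction A rule: infinite_finite_induct) (auto intro: multiplier_mult)

text \<open>Determinant trick: multiplication by \<open>w\<close> acts on the \<open>e i\<close>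
  through an integer matrix, and \<open>e\<close>, being a nonzero vector, is an eigenvector for
  \<open>w\<close>. Hence \<open>w\<close> is a root of the characteristic polynomial of that
  matrix, which is monic of degree \<open>d\<close>.\<close>

lemma multiplier_integral:
  fixes w :: "'a::field_char_0"
  assumes w: "multiplier e d w" and i0: "i0 < d" "e i0 \<noteq> 0"
  shows "\<exists>p :: int poly. degree p = d \<and> lead_coeff p = 1 \<and> poly (of_int_poly p) w = 0"
proof -
  have "\<forall>i. \<exists>a. i < d \<longrightarrow> w * e i = (\<Sum>j<d. of_int (a j) * e j)"
    using w by (auto simp: multiplier_def int_span_def)
  then obtain a where a: "\<And>i. i < d \<Longrightarrow> w * e i = (\<Sum>j<d. of_int (a i j) * e j)"
    by metis
  define A where "A = mat d d (\<lambda>(i, j). a i j)"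
  have A: "A \<in> carrier_mat d d" by (simp add: A_def)
  define A' where "A' = map_mat (of_int :: int \<Rightarrow> 'a) A"
  have A': "A' \<in> carrier_mat d d" using A by (simp add: A'_def)
  have "eigenvector A' (vec d e) w"
    unfolding eigenvector_def
  proof (intro conjI)
    show "vec d e \<in> carrier_vec (dim_row A')" using A' by simp
    show "vec d e \<noteq> 0\<^sub>v (dim_row A')"
    proof
      assume "vec d e = 0\<^sub>v (dim_row A')"
      then have "vec d e $ i0 = 0\<^sub>v d $ i0" using A' by simp
      then show False using i0 by simp
    qed
    show "A' *\<^sub>v vec d e = w \<cdot>\<^sub>v vec d e"
    proof (rule eq_vecI)
      show "dim_vec (A' *\<^sub>v vec d e) = dim_vec (w \<cdot>\<^sub>v vec d e)" using A' by simp
      fix i assume "i < dim_vec (w \<cdot>\<^sub>v vec d e)"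
      then have i: "i < d" by simp
      have "(A' *\<^sub>v vec d e) $ i = (\<Sum>j<d. of_int (a i j) * e j)"
        using i A by (simp add: A'_def A_def scalar_prod_def atLeast0LessThan)
      then show "(A' *\<^sub>v vec d e) $ i = (w \<cdot>\<^sub>v vec d e) $ i" using a[OF i] i by simp
    qed
  qed
  then have "eigenvalue A' w" unfolding eigenvalue_def by blast
  then have "poly (char_poly A') w = 0" using eigenvalue_root_char_poly[OF A'] by simp
  moreover have "char_poly A' = of_int_poly (char_poly A)"
    unfolding A'_def by (rule of_int_hom.char_poly_hom[OF A])
  ultimately show ?thesis using degree_monic_char_poly[OF A] by auto
qed

text \<open>The form in which the number field enters the proof: a fixed finite family whose
  integral span contains a positive multiple of every element. The family is an enumerated rational
  basis.\<close>

lemma number_field_int_span: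
  assumes "number_field TYPE('a::field_char_0)"
  obtains d and e :: "nat \<Rightarrow> 'a::field_char_0" and i where "i < d" "e i \<noteq> 0"
    "\<And>x. \<exists>N>0. of_int N * x \<in> int_span e d"
proof -
  obtain B :: "'a set" where "finite_dimensional_vector_space (\<lambda>(q::rat) x. of_rat q * x) B"
    using assms by (auto simp: number_field_def)
  then interpret V: finite_dimensional_vector_space "\<lambda>(q::rat) (x::'a). of_rat q * x" B .
  define d where "d = card B"
  obtain e where e: "bij_betw e {..<d} B"
    using ex_bij_betw_nat_finite[OF V.finite_Basis] by (auto simp: d_def atLeast0LessThan)
  have span: "\<exists>N>0. of_int N * x \<in> int_span e d" for x
  proof -
    have "x \<in> range (\<lambda>u. \<Sum>v\<in>B. of_rat (u v) * v)"
      using V.span_Basis V.span_finite[OF V.finite_Basis] by auto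
    then obtain u where "x = (\<Sum>v\<in>B. of_rat (u v) * v)" by blast
    then have x: "x = (\<Sum>j<d. of_rat (u (e j)) * e j)"
      using sum.reindex_bij_betw[OF e, of "\<lambda>v. of_rat (u v) * v"] by simp
    obtain N where N: "N > 0" "\<forall>q\<in>(\<lambda>j. u (e j)) ` {..<d}. \<exists>k. of_int N * q = of_int k"
      using common_denominator[of "(\<lambda>j. u (e j)) ` {..<d}"] by auto
    then have "\<forall>j. \<exists>k. j < d \<longrightarrow> of_int N * u (e j) = of_int k" by auto
    then obtain k where k: "\<And>j. j < d \<Longrightarrow> of_int N * u (e j) = of_int (k j)" by metis
    have "of_int N * x = (\<Sum>j<d. of_rat (of_int N * u (e j)) * e j)"
      unfolding x by (simp add: sum_distrib_left of_rat_mult mult.assoc)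
    also have "\<dots> = (\<Sum>j<d. of_int (k j) * e j)" using k by (intro sum.cong) simp_all
    finally show ?thesis using N unfolding int_span_def by blast
  qed
  have "\<exists>i<d. e i \<noteq> 0"
  proof (rule ccontr)
    assume "\<not> ?thesis"
    then have "int_span e d \<subseteq> {0}" by (auto simp: int_span_def)
    then show False using span[of 1] by auto
  qed
  then show ?thesis using span that by blast
qed

lemma multiplier_denominator:
  fixes x :: "'a::field_char_0"
  assumes span: "\<And>x::'a. \<exists>N>0. of_int N * x \<in> int_span e d"
  shows "\<exists>N>0. multiplier e d (of_int N * x)"
proof -
  obtain N where N: "\<And>i. N i > 0" "\<And>i. of_int (N i) * (x * e i) \<in> int_span e d"
    using span[of "x * e i" for i] by metis
  have "of_int (\<Prod>i<d. N i) * x * e i \<in> int_span e d" if "i < d" for i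
  proof -
    have "of_int (\<Prod>i<d. N i) * x * e i = of_int (\<Prod>j\<in>{..<d}-{i}. N j) * (of_int (N i) * (x * e i))"
      using that by (subst prod.remove[of _ i]) (auto simp: ac_simps)
    then show ?thesis using int_span_scale[OF N(2)] by metis
  qed
  then show ?thesis using N(1) unfolding multiplier_def
    by (intro exI[of _ "\<Prod>i<d. N i"]) (auto simp: prod_pos)
qed

text \<open>A multiple \<open>N * x\<close> is a multiplier, hence a root of a monic polynomial of
  degree \<open>d\<close>; substituting \<open>N X\<close> for the variable gives a polynomial for
  \<open>x\<close> of the same degree. The bound \<open>d\<close> does not depend on
  \<open>x\<close>.\<close>

lemma algebraic_degree_bound:
  fixes x :: "'a::field_char_0"
  assumes span: "\<And>x::'a. \<exists>N>0. of_int N * x \<in> int_span e d" and i: "i < d" "e i \<noteq> 0"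
  shows "\<exists>p :: int poly. p \<noteq> 0 \<and> degree p \<le> d \<and> poly (of_int_poly p) x = 0"
proof -
  obtain N where N: "N > 0" "multiplier e d (of_int N * x)"
    using multiplier_denominator[of e d x, OF span] by blast
  obtain p :: "int poly" where p: "degree p = d" "lead_coeff p = 1"
    "poly (of_int_poly p) (of_int N * x) = 0"
    using multiplier_integral[OF N(2) i] by blast
  define q where "q = p \<circ>\<^sub>p [:0, N:]"
  have "degree q = d" using p(1) N(1) by (simp add: q_def)
  moreover have "q \<noteq> 0" using i(1) \<open>degree q = d\<close> by auto
  moreover have "poly (of_int_poly q) x = 0"
    using p(3) by (simp add: q_def of_int_hom.map_poly_pcompose poly_pcompose hom_distribs mult.commute)
  ultimately show ?thesis by (intro exI[of _ q]) simp
qed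

text \<open>Gauss's lemma: the content of a monic polynomial is 1, so a minimal integer polynomial dividing
  it (up to a constant) is monic too.\<close>
lemma integral_minimal_polynomial:
  fixes z :: "'a::field_char_0"
  assumes P: "lead_coeff P = 1" "poly (of_int_poly P) z = 0"
  obtains p :: "int poly" where "lead_coeff p = 1" "poly (of_int_poly p) z = 0"
    "\<And>q. q \<noteq> 0 \<Longrightarrow> poly (of_int_poly q) z = 0 \<Longrightarrow> degree p \<le> degree q"
proof -
  define S where "S q \<longleftrightarrow> q \<noteq> 0 \<and> poly (of_int_poly q) z = 0" for q :: "int poly"
  have "S P" using P by (auto simp: S_def)
  define p where "p = arg_min degree S"
  have p: "S p" "\<And>q. S q \<Longrightarrow> degree p \<le> degree q"
    using arg_min_natI[of S, OF \<open>S P\<close>] arg_min_nat_le[of S] by (auto simp: p_def)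
  \<comment> \<open>Division over the integers requires the factor \<open>c\<close>, a power of the
    leading coefficient of \<open>p\<close>. The remainder annihilates \<open>z\<close> and so
    vanishes by minimality of \<open>degree p\<close>.\<close>
  obtain q r where qr: "pseudo_divmod P p = (q, r)" by force
  define c where "c = coeff p (degree p) ^ (Suc (degree P) - degree p)"
  have p0: "p \<noteq> 0" using p(1) by (simp add: S_def)
  have div: "Polynomial.smult c P = p * q + r" "r = 0 \<or> degree r < degree p"
    using pseudo_divmod[OF p0 qr] by (simp_all add: c_def)
  have c0: "c \<noteq> 0" using p0 by (simp add: c_def)
  have "of_int_poly r = Polynomial.smult (of_int c) (of_int_poly P) - of_int_poly p * (of_int_poly q :: 'a poly)"
    using arg_cong[OF div(1), of "of_int_poly :: int poly \<Rightarrow> 'a poly"]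
      by (simp add: hom_distribs)
  then have "poly (of_int_poly r) z = 0" using P(2) p(1) by (simp add: S_def)
  then have "r = 0" using div(2) p(2)[of r] unfolding S_def by (meson leD)
  then have eq: "Polynomial.smult c P = p * q" using div(1) by simp
  have "content P dvd lead_coeff P" by (rule content_dvd_coeff)
  then have cP: "content P = 1" using P(1) by (metis normalize_content is_unit_normalize)
  have "\<bar>c\<bar> = content p * content q"
    using arg_cong[OF eq, of content] cP by (simp add: content_mult)
  define p' where "p' = primitive_part p"
  define q' where "q' = primitive_part q"
  \<comment> \<open>As \<open>content P = 1\<close>, the contents of \<open>p\<close> and
    \<open>q\<close> multiply to the absolute value of \<open>c\<close>. Cancelling them leaves
    \<open>P\<close> equal to \<open>p' * q'\<close> up to sign, so that the leading coefficient of
    \<open>p'\<close> is a unit.\<close>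
  have "Polynomial.smult c P = Polynomial.smult (content p * content q) (p' * q')"
    unfolding eq p'_def q'_def
    by (metis content_times_primitive_part mult_smult_left mult_smult_right smult_smult)
  then have "Polynomial.smult c P = Polynomial.smult \<bar>c\<bar> (p' * q')"
    using \<open>\<bar>c\<bar> = _\<close> by simp
  then have "c * lead_coeff P = \<bar>c\<bar> * (lead_coeff p' * lead_coeff q')"
    by (metis lead_coeff_smult lead_coeff_mult)
  then have "lead_coeff p' * lead_coeff q' = 1 \<or> lead_coeff p' * lead_coeff q' = -1"
  proof (cases "c > 0")
    case False
    then have "c * (lead_coeff p' * lead_coeff q' + 1) = 0"
      using \<open>c * lead_coeff P = _\<close> P(1) by (simp add: algebra_simps)
    then show ?thesis using c0 by (simp add: eq_neg_iff_add_eq_0)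
  qed (use \<open>c * lead_coeff P = _\<close> P(1) in simp)
  then have "lead_coeff p' dvd 1" by (metis dvd_triv_left dvd_minus_iff)
  then have lc: "lead_coeff p' = 1 \<or> lead_coeff p' = -1" by (simp add: zdvd1_eq abs_if split: if_splits)
  have dp': "degree p' = degree p" by (simp add: p'_def)
  have "of_int_poly p = Polynomial.smult (of_int (content p)) (of_int_poly p' :: 'a poly)"
    unfolding p'_def by (metis content_times_primitive_part of_int_hom.map_poly_hom_smult)
  then have p'z: "poly (of_int_poly p') z = 0" using p(1) p0 by (simp add: S_def)
  show ?thesis
  proof (cases "lead_coeff p' = 1")
    case True
    then show ?thesis using that[of p'] p'z p(2) dp' by (simp add: S_def)
  next
    case False
    then have "lead_coeff (- p') = 1" using lc by simp
    moreover have "poly (of_int_poly (- p')) z = 0" using p'z by (simp add: hom_distribs)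
    ultimately show ?thesis using that[of "- p'"] p(2) dp' by (simp add: S_def)
  qed
qed

section \<open>Polynomials acting on functions through multiplication by \<open>y\<close>\<close>

lemma additive_of_int:
  fixes f :: "'a::comm_ring_1 \<Rightarrow> 'b::comm_ring_1"
  assumes "additive f" shows "f (of_int k * x) = of_int k * f x"
proof -
  interpret additive f by fact
  have nat: "f (of_nat n * x) = of_nat n * f x" for n
    by (induction n) (simp_all add: zero add algebra_simps)
  show ?thesis by (cases k rule: int_cases2) (simp_all add: nat minus)
qed

text \<open>The variable acts on functions by precomposition with multiplication by
  \<open>y\<close>, so polynomials over a second ring can be applied although \<open>y\<close>
  itself lies in the first. The cutoff \<open>n\<close>, kept apart from the degree, makes the sum
  linear in \<open>c\<close>.\<close>

definition poly_act :: "nat \<Rightarrow> 'b::comm_ring_1 poly \<Rightarrow> 'a::comm_ring_1 \<Rightarrow> ('a \<Rightarrow> 'b) \<Rightarrow> 'a \<Rightarrow> 'b"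
  where "poly_act n c y f x = (\<Sum>i<n. coeff c i * f (y ^ i * x))"

text \<open>Acting by a product is acting successively by its factors. The cutoff drops from
  \<open>Suc n\<close> to \<open>n\<close> because the coefficient of \<open>q\<close> at
  \<open>n\<close> vanishes.\<close>

lemma poly_act_linear_factor:
  assumes "degree q < n"
  shows "poly_act (Suc n) ([:-\<mu>, 1:] * q) y f x = poly_act n q y (\<lambda>x. f (y * x) - \<mu> * f x) x"
proof -
  have "coeff q n = 0" using assms coeff_eq_0 by blast
  have "coeff ([:-\<mu>, 1:] * q) i = coeff (pCons 0 q) i - \<mu> * coeff q i" for i
    by simp
  then have "poly_act (Suc n) ([:-\<mu>, 1:] * q) y f x =
    (\<Sum>i<Suc n. coeff (pCons 0 q) i * f (y ^ i * x)) - (\<Sum>i<Suc n. \<mu> * coeff q i * f (y ^ i * x))"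
    unfolding poly_act_def sum_subtractf[symmetric] by (simp only: left_diff_distrib)
  also have "(\<Sum>i<Suc n. coeff (pCons 0 q) i * f (y ^ i * x)) = (\<Sum>i<n. coeff q i * f (y ^ Suc i * x))"
    by (subst sum.lessThan_Suc_shift) simp
  also have "(\<Sum>i<Suc n. \<mu> * coeff q i * f (y ^ i * x)) = (\<Sum>i<n. \<mu> * coeff q i * f (y ^ i * x))"
    using \<open>coeff q n = 0\<close> by simp
  finally show ?thesis by (simp add: poly_act_def sum_subtractf[symmetric] algebra_simps)
qed

text \<open>For integer coefficients the additivity of \<open>f\<close> moves the polynomial inside
  the argument. Thus an integer polynomial that vanishes at \<open>y\<close> annihilates every
  additive function.\<close>

lemma poly_act_annihilator:
  fixes y :: "'a::field_char_0"
  assumes "additive f" "degree p < n"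
  shows "poly_act n (of_int_poly p) y f x = f (poly (of_int_poly p) y * x)"
proof -
  interpret additive f by fact
  have "poly (of_int_poly p) y = (\<Sum>i<n. of_int (coeff p i) * y ^ i)"
  proof -
    have "poly (of_int_poly p) y = (\<Sum>i\<le>degree p. of_int (coeff p i) * y ^ i)"
      by (simp add: poly_altdef of_int_hom.degree_map_poly_hom)
    also have "\<dots> = (\<Sum>i<n. of_int (coeff p i) * y ^ i)"
      using assms(2) by (intro sum.mono_neutral_left) (auto simp: coeff_eq_0)
    finally show ?thesis .
  qed
  then have "f (poly (of_int_poly p) y * x) = (\<Sum>i<n. f (of_int (coeff p i) * (y ^ i * x)))"
    by (simp add: sum_distrib_right sum mult.assoc)
  then show ?thesis by (simp add: poly_act_def additive_of_int[OF assms(1)])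
qed

section \<open>Conjugates via joint eigenfunctions\<close>

text \<open>Split off a root \<mu> of \<open>c\<close>. Either \<open>f\<close> is already an
  eigenfunction for \<mu>, or \<open>f (y * x) - \<mu> * f x\<close> is a nonzero member of
  \<open>W\<close> killed by the cofactor of smaller degree. A nonzero constant kills no nonzero
  function, so the descent stops at an eigenfunction.\<close>

lemma eigenfunction_exists:
  fixes c :: "complex poly" and f :: "'a::comm_ring_1 \<Rightarrow> complex"
  assumes "c \<noteq> 0" "degree c < n" "\<And>x. poly_act n c y f x = 0" "f \<in> W"
    "\<exists>x. f x \<noteq> 0"
    and W: "\<And>f \<mu>. f \<in> W \<Longrightarrow> (\<lambda>x. f (y * x) - \<mu> * f x) \<in> W"
  shows "\<exists>\<mu>. poly c \<mu> = 0 \<and> (\<exists>g\<in>W. (\<exists>x. g x \<noteq> 0) \<and> (\<forall>x. g (y * x) = \<mu> * g x))"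
  using assms(1-5)
proof (induction "degree c" arbitrary: c f n)
  case 0
  then obtain a where c: "c = [:a:]" by (metis degree_eq_zeroE)
  with 0 have "a \<noteq> 0" by simp
  have "poly_act n c y f x = a * f x" for x
    using \<open>degree c < n\<close>
      by (cases n) (simp_all add: poly_act_def c sum.lessThan_Suc_shift del: sum.lessThan_Suc)
  then show ?case using 0 \<open>a \<noteq> 0\<close> by auto
next
  case (Suc m)
  have "\<not> constant (poly c)" using Suc(2) by (simp add: constant_degree)
  then obtain \<mu> where \<mu>: "poly c \<mu> = 0" using fundamental_theorem_of_algebra by blast
  then obtain q where q: "c = [:-\<mu>, 1:] * q" using poly_eq_0_iff_dvd by (metis dvdE)
  with Suc have q0: "q \<noteq> 0" by auto
  have "degree c = Suc (degree q)" unfolding q using q0 by (subst degree_mult_eq) auto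
  then have dq: "m = degree q" using Suc(2) by simp
  obtain k where n: "n = Suc k" "degree q < k" using Suc(2,4) dq by (cases n) auto
  define h where "h = (\<lambda>x. f (y * x) - \<mu> * f x)"
  have act: "poly_act k q y h x = 0" for x
    using Suc(5)[of x] poly_act_linear_factor[OF n(2), of \<mu> y f x] by (simp add: n q h_def)
  show ?case
  proof (cases "\<exists>x. h x \<noteq> 0")
    case True
    have "h \<in> W" using W Suc(6) by (simp add: h_def)
    from Suc(1)[OF dq q0 n(2) act this True] obtain \<nu> where "poly q \<nu> = 0"
      "\<exists>g\<in>W. (\<exists>x. g x \<noteq> 0) \<and> (\<forall>x. g (y * x) = \<nu> * g x)" by blast
    then show ?thesis by (intro exI[of _ \<nu>]) (simp add: q)
  next
    case False
    then show ?thesis using \<mu> Suc(6,7) by (auto simp: h_def intro!: exI[of _ \<mu>] bexI[of _ f])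
  qed
qed

text \<open>Minimality is expressed through the degree rather than irreducibility, since linear
  independence of the lower powers of \<open>z\<close> is what is drawn from it.\<close>

definition int_minimal :: "int poly \<Rightarrow> 'a::field_char_0 \<Rightarrow> bool"
  where "int_minimal p z \<longleftrightarrow> p \<noteq> 0 \<and> poly (of_int_poly p) z = 0 \<and>
    (\<forall>q. q \<noteq> 0 \<longrightarrow> poly (of_int_poly q) z = 0 \<longrightarrow> degree p \<le> degree q)"

text \<open>Clearing denominators in a nontrivial rational relation would produce a nonzero integer
  polynomial of smaller degree vanishing at \<open>z\<close>.\<close>

lemma int_minimal_powers_independent:
  fixes z :: "'a::field_char_0"
  assumes p: "int_minimal p z" and u: "(\<Sum>i<degree p. of_rat (u i) * z ^ i) = 0" and i: "i < degree p"
  shows "u i = 0"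
proof (rule ccontr)
  assume ui: "u i \<noteq> 0"
  let ?n = "degree p"
  obtain N where N: "N > 0" "\<forall>q\<in>u ` {..<?n}. \<exists>k. of_int N * q = of_int k"
    using common_denominator[of "u ` {..<?n}"] by auto
  then have "\<forall>j. \<exists>k. j < ?n \<longrightarrow> of_int N * u j = of_int k" by auto
  then obtain k where k: "\<And>j. j < ?n \<Longrightarrow> of_int N * u j = of_int (k j)" by metis
  define q where "q = (\<Sum>j<?n. monom (k j) j)"
  have "coeff q i = k i" using i by (simp add: q_def coeff_sum coeff_monom)
  moreover have "k i \<noteq> 0"
  proof
    assume "k i = 0"
    then have "of_int N * u i = 0" using k[OF i] by simp
    then show False using N(1) ui by simp
  qed
  ultimately have "q \<noteq> 0" by auto
  have "poly (of_int_poly q) z = (\<Sum>j<?n. of_int (k j) * z ^ j)"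
    by (simp add: q_def hom_distribs poly_sum poly_monom)
  also have "\<dots> = (\<Sum>j<?n. of_rat (of_int N * u j) * z ^ j)"
    using k by (intro sum.cong) simp_all
  also have "\<dots> = of_int N * (\<Sum>j<?n. of_rat (u j) * z ^ j)"
    by (simp add: sum_distrib_left of_rat_mult mult.assoc)
  finally have "poly (of_int_poly q) z = 0" using u by simp
  then have "?n \<le> degree q" using p \<open>q \<noteq> 0\<close> by (auto simp: int_minimal_def)
  moreover have "degree q < ?n"
    unfolding q_def using i by (intro degree_sum_less) (auto intro: le_less_trans[OF degree_monom_le])
  ultimately show False by simp
qed

text \<open>The powers of \<open>z\<close> below the degree are independent over the rationals, so a
  rational-linear map into the complex numbers may take any values on them.\<close>

lemma additive_with_prescribed_powers:
  fixes z :: "'a::field_char_0"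
  assumes p: "int_minimal p z"
  shows "\<exists>f :: 'a \<Rightarrow> complex. additive f \<and> (\<forall>i<degree p. f (z ^ i) = c i)"
proof -
  let ?n = "degree p"
  interpret V: vector_space_pair "\<lambda>(q::rat) (x::'a). of_rat q * x" "\<lambda>(q::rat) (x::complex). of_rat q * x"
    by unfold_locales (simp_all add: algebra_simps of_rat_add of_rat_mult)
  have inj: "inj_on (\<lambda>i. z ^ i) {..<?n}"
  proof (rule inj_onI, rule ccontr)
    fix i j assume ij: "i \<in> {..<?n}" "j \<in> {..<?n}" "z ^ i = z ^ j" "i \<noteq> j"
    define u :: "nat \<Rightarrow> rat"
      where "u k = (if k = i then 1 else 0) - (if k = j then 1 else 0)" for k
    have "(\<Sum>k<?n. of_rat (u k) * z ^ k) = (\<Sum>k<?n. (if k = i then z ^ k else 0) - (if k = j then z ^ k else 0))"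
      by (intro sum.cong) (auto simp: u_def of_rat_diff)
    also have "\<dots> = 0" using ij by (simp add: sum_subtractf)
    finally have "u i = 0" using int_minimal_powers_independent[OF p] ij(1) by blast
    then show False using ij(4) by (simp add: u_def)
  qed
  let ?C = "(\<lambda>i. z ^ i) ` {..<?n}"
  have ind: "V.vs1.independent ?C"
    unfolding V.vs1.independent_explicit_finite_subsets
  proof (intro allI impI ballI)
    fix S u v assume S: "S \<subseteq> ?C" "finite S" "(\<Sum>v\<in>S. of_rat (u v) * v) = 0" "v \<in> S"
    define w where "w i = (if z ^ i \<in> S then u (z ^ i) else 0)" for i
    have "(\<Sum>i<?n. of_rat (w i) * z ^ i) = (\<Sum>x\<in>?C. of_rat (if x \<in> S then u x else 0) * x)"
      using inj by (subst sum.reindex) (simp_all add: w_def)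
    also have "\<dots> = (\<Sum>v\<in>S. of_rat (u v) * v)"
      using S by (intro sum.mono_neutral_cong_right) auto
    finally have "(\<Sum>i<?n. of_rat (w i) * z ^ i) = 0" using S by simp
    then have "w i = 0" if "i < ?n" for i using int_minimal_powers_independent[OF p] that by blast
    then show "u v = 0" using S by (force simp: w_def)
  qed
  let ?f = "V.construct ?C (\<lambda>v. c (the_inv_into {..<?n} (\<lambda>i. z ^ i) v))"
  have lin: "Vector_Spaces.linear (\<lambda>(q::rat) (x::'a). of_rat q * x) (\<lambda>(q::rat) (x::complex). of_rat q * x) ?f"
    by (rule V.linear_construct[OF ind])
  have "?f (x + y) = ?f x + ?f y" for x y by (rule V.linear_add[OF lin])
  then have "additive ?f" by unfold_locales
  moreover have "?f (z ^ i) = c i" if "i < ?n" for i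
    using that by (subst V.construct_basis[OF ind]) (simp_all add: the_inv_into_f_f[OF inj])
  ultimately show ?thesis by blast
qed

text \<open>With \<open>p = (X - \<alpha>) q\<close>, let \<open>q\<close> act on an additive
  \<open>f\<close>: since \<open>p\<close> kills \<open>f\<close>, the factor
  \<open>X - \<alpha>\<close> kills the result \<open>g\<close>, which is therefore an eigenfunction
  for \<alpha>.\<close>

lemma additive_eigenfunction_of_root:
  fixes z :: "'a::field_char_0"
  assumes p: "int_minimal p z" and \<alpha>: "poly (of_int_poly p) (\<alpha>::complex) = 0"
  shows "\<exists>f :: 'a \<Rightarrow> complex. additive f \<and> (\<exists>x. f x \<noteq> 0) \<and> (\<forall>x. f (z * x) = \<alpha> * f x)"
proof -
  define n where "n = degree p"
  obtain q where q: "of_int_poly p = [:-\<alpha>, 1:] * q" using \<alpha> poly_eq_0_iff_dvd by (metis dvdE)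
  have p0: "p \<noteq> 0" using p by (simp add: int_minimal_def)
  have "of_int_poly p \<noteq> (0::complex poly)" using p0 by simp
  then have q0: "q \<noteq> 0" using q by auto
  have "degree (of_int_poly p :: complex poly) = Suc (degree q)" unfolding q using q0
    by (subst degree_mult_eq) auto
  then have n: "n = Suc (degree q)" by (simp add: n_def)
  \<comment> \<open>These values single out the top coefficient of \<open>q\<close>, so that
    \<open>g 1 = lead_coeff q\<close> and \<open>g\<close> is nonzero.\<close>
  obtain f :: "'a \<Rightarrow> complex" where f: "additive f" and f1:
    "\<forall>i<degree p. f (z ^ i) = (if i = degree q then 1 else 0)"
    using additive_with_prescribed_powers[OF p, of "\<lambda>i. if i = degree q then 1 else 0"] by blast
  interpret additive f by fact
  define g where "g = (\<lambda>x. poly_act n q z f x)"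
  have "g 1 = (\<Sum>i<n. if i = degree q then coeff q i else 0)"
    unfolding g_def poly_act_def n_def using f1 by (intro sum.cong) auto
  also have "\<dots> = lead_coeff q" using n by simp
  finally have "g 1 \<noteq> 0" using q0 by simp
  moreover have "additive g"
    by unfold_locales (simp add: g_def poly_act_def algebra_simps add sum.distrib)
  moreover have "g (z * x) = \<alpha> * g x" for x
  proof -
    have "g (z * x) - \<alpha> * g x = poly_act n q z (\<lambda>x. f (z * x) - \<alpha> * f x) x"
      by (simp add: g_def poly_act_def sum_distrib_left sum_subtractf[symmetric] algebra_simps)
    also have "\<dots> = poly_act (Suc n) (of_int_poly p) z f x"
      unfolding q using n by (subst poly_act_linear_factor) simp_all
    also have "\<dots> = f (poly (of_int_poly p) z * x)"
      by (rule poly_act_annihilator[OF f]) (simp add: n_def)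
    also have "\<dots> = 0" using p by (simp add: int_minimal_def zero)
    finally show ?thesis by simp
  qed
  ultimately show ?thesis by blast
qed

text \<open>A joint eigenfunction plays the role of a field embedding into the complex numbers; only its values
  on finitely many multipliers matter, so no extension argument for embeddings is needed.\<close>
lemma joint_eigenfunction:
  fixes z :: "'a::field_char_0" and g :: "nat \<Rightarrow> 'a"
  assumes p: "int_minimal p z" and \<alpha>: "poly (of_int_poly p) (\<alpha>::complex) = 0"
    and P: "\<And>i. i < r \<Longrightarrow> P i \<noteq> 0"
      "\<And>i. i < r \<Longrightarrow> poly (of_int_poly (P i)) (g i) = 0"
  shows "\<exists>f :: 'a \<Rightarrow> complex. \<exists>\<mu>. additive f \<and> (\<exists>x. f x \<noteq> 0) \<and> (\<forall>x. f (z * x) = \<alpha> * f x) \<and>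
    (\<forall>i<r. poly (of_int_poly (P i)) (\<mu> i) = 0 \<and> (\<forall>x. f (g i * x) = \<mu> i * f x))"
  using P
proof (induction r)
  case 0
  then show ?case using additive_eigenfunction_of_root[OF p \<alpha>] by simp
next
  case (Suc r)
  then obtain f :: "'a \<Rightarrow> complex" and \<mu> where f: "additive f"
    "\<exists>x. f x \<noteq> 0" "\<forall>x. f (z * x) = \<alpha> * f x" and
    \<mu>: "\<forall>i<r. poly (of_int_poly (P i)) (\<mu> i) = 0 \<and> (\<forall>x. f (g i * x) = \<mu> i * f x)"
    by auto
  \<comment> \<open>\<open>W\<close> records the eigenvalue equations obtained so far.
    Multiplication by \<open>g r\<close> commutes with multiplication by \<open>z\<close> and by the
    earlier \<open>g i\<close>, so these equations survive while an eigenvalue for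
    \<open>g r\<close> is extracted.\<close>
  define W where "W = {f :: 'a \<Rightarrow> complex. additive f \<and> (\<forall>x. f (z * x) = \<alpha> * f x) \<and>
    (\<forall>i<r. \<forall>x. f (g i * x) = \<mu> i * f x)}"
  have fW: "f \<in> W" using f \<mu> by (simp add: W_def)
  have W: "(\<lambda>x. h (g r * x) - \<nu> * h x) \<in> W" if "h \<in> W" for h \<nu>
  proof -
    have h: "additive h" "\<And>x. h (z * x) = \<alpha> * h x" "\<And>i x. i < r \<Longrightarrow> h (g i * x) = \<mu> i * h x"
      using that by (auto simp: W_def)
    interpret additive h by fact
    have "additive (\<lambda>x. h (g r * x) - \<nu> * h x)"
      by unfold_locales (simp add: add algebra_simps)
    moreover have "h (g r * (z * x)) = \<alpha> * h (g r * x)" for x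
      using h(2)[of "g r * x"] by (simp add: ac_simps)
    moreover have "h (g r * (g i * x)) = \<mu> i * h (g r * x)" if "i < r" for i x
      using h(3)[OF that, of "g r * x"] by (simp add: ac_simps)
    ultimately show ?thesis using h(2,3) by (simp add: W_def algebra_simps)
  qed
  have "poly_act (Suc (degree (P r))) (of_int_poly (P r)) (g r) f x = 0" for x
  proof -
    interpret additive f by fact
    show ?thesis using poly_act_annihilator[OF f(1), of "P r" "Suc (degree (P r))" "g r" x] Suc(3)[of r]
      by (simp add: zero)
  qed
  then obtain \<nu> h where \<nu>: "poly (of_int_poly (P r)) \<nu> = 0" and h: "h \<in> W"
    "\<exists>x. h x \<noteq> 0" "\<forall>x. h (g r * x) = \<nu> * h x"
    using eigenfunction_exists[of "of_int_poly (P r)" "Suc (degree (P r))" "g r" f W] Suc(2)[of r] W fW f(2)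
    by auto
  show ?case
    using h \<nu> \<mu> by (intro exI[of _ h] exI[of _ "\<mu>(r := \<nu>)"]) (auto simp: W_def less_Suc_eq)
qed

lemma additive_prod_power:
  fixes r :: nat
  assumes "\<And>i x. i < r \<Longrightarrow> f (g i * x) = \<mu> i * (f x :: complex)"
  shows "f ((\<Prod>i<r. g i ^ b i) * (x :: 'a::comm_ring_1)) = (\<Prod>i<r. \<mu> i ^ b i) * f x"
  using assms
proof (induction r arbitrary: x)
  case (Suc r)
  have pow: "f (g r ^ k * x) = \<mu> r ^ k * f x" for k x
    using Suc(2)[of r] by (induction k arbitrary: x) (simp_all add: mult.assoc)
  show ?case using Suc by (simp add: mult.assoc pow)
qed simp

text \<open>On a joint eigenfunction the equation for \<open>(D y) ^ m\<close> becomes the same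
  equation between \<alpha>, \<open>D\<close> and roots \<mu> of the \<open>P i\<close>. Since
  \<open>b i < m\<close> and \<open>1 \<le> C i\<close>, each exponent may be raised to
  \<open>m\<close>, and taking \<open>m\<close>-th roots gives a bound free of
  \<open>m\<close>.\<close>

lemma conjugate_bound:
  fixes y :: "'a::field_char_0" and g :: "nat \<Rightarrow> 'a"
  assumes p: "int_minimal p (of_int D * y)" and \<alpha>: "poly (of_int_poly p) (\<alpha>::complex) = 0"
    and P: "\<And>i. i < r \<Longrightarrow> P i \<noteq> 0"
      "\<And>i. i < r \<Longrightarrow> poly (of_int_poly (P i)) (g i) = 0"
    and C: "\<And>i \<mu>. i < r \<Longrightarrow> poly (of_int_poly (P i)) \<mu> = 0 \<Longrightarrow> cmod \<mu> \<le> C i"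
    and C1: "\<And>i. i < r \<Longrightarrow> 1 \<le> C i"
    and y: "y ^ m = (\<Prod>i<r. g i ^ b i)" "m > 0" "\<And>i. i < r \<Longrightarrow> b i < m"
  shows "cmod \<alpha> \<le> \<bar>of_int D\<bar> * (\<Prod>i<r. C i)"
proof -
  let ?z = "of_int D * y"
  obtain f :: "'a \<Rightarrow> complex" and \<mu> where f: "additive f" "\<exists>x. f x \<noteq> 0"
    "\<forall>x. f (?z * x) = \<alpha> * f x" and
    \<mu>: "\<forall>i<r. poly (of_int_poly (P i)) (\<mu> i) = 0 \<and> (\<forall>x. f (g i * x) = \<mu> i * f x)"
    using joint_eigenfunction[OF p \<alpha>, of r P g] P by blast
  obtain x where x: "f x \<noteq> 0" using f by blast
  have zm: "f (?z ^ k * x) = \<alpha> ^ k * f x" for k x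
    using f(3) by (induction k arbitrary: x) (simp_all add: mult.assoc)
  have "\<alpha> ^ m * f x = f (of_int (D ^ m) * ((\<Prod>i<r. g i ^ b i) * x))"
    using zm[of m x] y(1) by (simp add: power_mult_distrib mult.assoc)
  also have "\<dots> = of_int (D ^ m) * ((\<Prod>i<r. \<mu> i ^ b i) * f x)"
    unfolding additive_of_int[OF f(1)] using additive_prod_power[of r f g \<mu> b x] \<mu> by simp
  finally have "\<alpha> ^ m = of_int (D ^ m) * (\<Prod>i<r. \<mu> i ^ b i)" using x by simp
  then have "cmod \<alpha> ^ m = \<bar>of_int D\<bar> ^ m * (\<Prod>i<r. cmod (\<mu> i) ^ b i)"
    by (metis (no_types, lifting) norm_mult norm_power norm_of_int of_int_power prod_norm prod.cong)
  also have "(\<Prod>i<r. cmod (\<mu> i) ^ b i) \<le> (\<Prod>i<r. C i ^ m)"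
  proof (intro prod_mono conjI)
    fix i assume "i \<in> {..<r}"
    then have i: "i < r" by simp
    have "cmod (\<mu> i) ^ b i \<le> C i ^ b i" using C[OF i] \<mu> i by (intro power_mono) auto
    also have "\<dots> \<le> C i ^ m" using C1[OF i] y(3)[OF i] by (intro power_increasing) auto
    finally show "cmod (\<mu> i) ^ b i \<le> C i ^ m" .
  qed simp
  finally have "cmod \<alpha> ^ m \<le> (\<bar>of_int D\<bar> * (\<Prod>i<r. C i)) ^ m"
    by (simp add: power_mult_distrib prod_power_distrib mult_left_mono)
  moreover have "0 \<le> \<bar>of_int D\<bar> * (\<Prod>i<r. C i)"
    using C1 by (intro mult_nonneg_nonneg prod_nonneg) (auto intro: order_trans[of 0 1])
  ultimately show ?thesis using y(2) by (simp add: power_mono_iff)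
qed

section \<open>Finiteness from bounded degrees and conjugates\<close>

lemma coeff_bound_of_roots:
  fixes c :: "complex poly"
  assumes "lead_coeff c = 1" "\<And>x. poly c x = 0 \<Longrightarrow> cmod x \<le> R" "R \<ge> 0"
  shows "cmod (coeff c i) \<le> (1 + R) ^ degree c"
proof -
  obtain as where as: "(\<Prod>a\<leftarrow>as. [:-a, 1:]) = c" "length as = degree c"
    using fundamental_theorem_algebra_factorized[of c] assms(1) by auto
  have "\<forall>a\<in>set as. cmod a \<le> R"
  proof
    fix a assume "a \<in> set as"
    then have "poly c a = 0" unfolding as(1)[symmetric] by (induction as) auto
    then show "cmod a \<le> R" by (rule assms(2))
  qed
  \<comment> \<open>Each factor \<open>X - a\<close> with \<open>cmod a \<le> R\<close> enlarges the
    bound on the coefficients by at most the factor \<open>1 + R\<close>.\<close>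
  then have "cmod (coeff (\<Prod>a\<leftarrow>as. [:-a, 1:]) i) \<le> (1 + R) ^ length as" for i
  proof (induction as arbitrary: i)
    case Nil
    then show ?case by simp
  next
    case (Cons a as)
    let ?q = "\<Prod>a\<leftarrow>as. [:-a, 1:]"
    have "coeff ([:-a, 1:] * ?q) i = coeff (pCons 0 ?q) i - a * coeff ?q i" by simp
    then have "cmod (coeff ([:-a, 1:] * ?q) i) \<le> cmod (coeff (pCons 0 ?q) i) + cmod (a * coeff ?q i)"
      by (simp only: norm_triangle_ineq4)
    moreover have "cmod (coeff (pCons 0 ?q) i) \<le> (1 + R) ^ length as"
      using Cons assms(3) by (cases i) auto
    moreover have "cmod (a * coeff ?q i) \<le> R * (1 + R) ^ length as"
      unfolding norm_mult using Cons assms(3) by (intro mult_mono) auto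
    ultimately have "cmod (coeff ([:-a, 1:] * ?q) i) \<le> (1 + R) ^ length as + R * (1 + R) ^ length as"
      by linarith
    then show ?case by (simp add: algebra_simps)
  qed
  then show ?thesis using as by metis
qed

lemma finite_bounded_int_polys: "finite {p :: int poly. degree p \<le> n \<and> (\<forall>i. \<bar>coeff p i\<bar> \<le> b)}"
proof (rule finite_subset)
  show "{p :: int poly. degree p \<le> n \<and> (\<forall>i. \<bar>coeff p i\<bar> \<le> b)} \<subseteq>
    Poly ` {xs. set xs \<subseteq> {-b..b} \<and> length xs \<le> Suc n}"
  proof
    fix p :: "int poly" assume "p \<in> {p. degree p \<le> n \<and> (\<forall>i. \<bar>coeff p i\<bar> \<le> b)}"
    then have p: "degree p \<le> n" "\<And>i. \<bar>coeff p i\<bar> \<le> b" by auto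
    have "set (coeffs p) \<subseteq> {-b..b}"
    proof
      fix x assume "x \<in> set (coeffs p)"
      then obtain i where "x = coeff p i" by (auto simp: coeffs_def split: if_splits)
      then show "x \<in> {-b..b}" using p(2)[of i] by (auto simp: abs_le_iff)
    qed
    moreover have "length (coeffs p) \<le> Suc n" using p(1) by (simp add: coeffs_def)
    ultimately show "p \<in> Poly ` {xs. set xs \<subseteq> {-b..b} \<and> length xs \<le> Suc n}"
      by (intro image_eqI[of _ _ "coeffs p"]) auto
  qed
  show "finite (Poly ` {xs. set xs \<subseteq> {-b..b} \<and> length xs \<le> Suc n})"
    by (intro finite_imageI finite_lists_length_le) simp
qed

lemma finite_roots_of_bounded_int_polys:
  "finite {z :: 'a::field_char_0. \<exists>p. p \<noteq> 0 \<and> degree p \<le> n \<and> (\<forall>i. \<bar>coeff p i\<bar> \<le> b) \<and> poly (of_int_poly p) z = 0}"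
    (is "finite ?Z")
proof (rule finite_subset)
  let ?S = "{p :: int poly. degree p \<le> n \<and> (\<forall>i. \<bar>coeff p i\<bar> \<le> b)} - {0}"
  show "?Z \<subseteq> (\<Union>p\<in>?S. {z. poly (of_int_poly p) z = 0})" by auto
  show "finite (\<Union>p\<in>?S. {z :: 'a. poly (of_int_poly p) z = 0})"
    using finite_bounded_int_polys[of n b] by (intro finite_UN_I poly_roots_finite) auto
qed

text \<open>Northcott's argument: \<open>d\<close>, \<open>D\<close> and \<open>R\<close> are fixed
  before \<open>y\<close> and \<open>m\<close>, while the monic minimal polynomial of
  \<open>D y\<close> has degree at most \<open>d\<close> and roots of modulus at most
  \<open>R\<close>. This leaves finitely many polynomials, hence finitely many
  \<open>y\<close>.\<close>

lemma finite_bounded_radicals: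
  fixes g :: "nat \<Rightarrow> 'a::field_char_0"
  assumes "number_field TYPE('a)"
  shows "finite {y. \<exists>m>0. \<exists>b. (\<forall>i<r. b i < m) \<and> y ^ m = (\<Prod>i<r. g i ^ b i)}" (is "finite ?Y")
proof -
  obtain d and e :: "nat \<Rightarrow> 'a" and i0 where i0: "i0 < d" "e i0 \<noteq> 0" and
    span: "\<And>x. \<exists>N>0. of_int N * x \<in> int_span e d"
    using number_field_int_span[OF assms] by metis
  have "\<forall>i. \<exists>N>0. multiplier e d (of_int N * g i)"
    using multiplier_denominator[of e d, OF span] by blast
  then obtain N where N: "\<And>i. N i > 0" "\<And>i. multiplier e d (of_int (N i) * g i)" by metis
  define D where "D = (\<Prod>i<r. N i)"
  have D: "D > 0" using N(1) by (simp add: D_def prod_pos)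
  have "\<forall>i. \<exists>p :: int poly. p \<noteq> 0 \<and> poly (of_int_poly p) (g i) = 0"
    using algebraic_degree_bound[of e d, OF span i0] by blast
  then obtain P :: "nat \<Rightarrow> int poly" where P: "\<And>i. P i \<noteq> 0"
    "\<And>i. poly (of_int_poly (P i)) (g i) = 0" by metis
  have "\<exists>C\<ge>1. \<forall>\<mu>::complex. poly (of_int_poly (P i)) \<mu> = 0 \<longrightarrow> cmod \<mu> \<le> C" for i
  proof -
    have "finite {\<mu>::complex. poly (of_int_poly (P i)) \<mu> = 0}" using P(1)
      by (intro poly_roots_finite) simp
    \<comment> \<open>Inserting 1 makes the maximum defined when there are no roots, and gives
      \<open>1 \<le> C i\<close>.\<close>
    then show ?thesis
      by (intro exI[of _ "Max (insert 1 (cmod ` {\<mu>. poly (of_int_poly (P i)) \<mu> = 0}))"]) auto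
  qed
  then obtain C where C: "\<And>i. 1 \<le> C i"
    "\<And>i \<mu>. poly (of_int_poly (P i)) (\<mu>::complex) = 0 \<Longrightarrow> cmod \<mu> \<le> C i"
    by metis
  define R where "R = \<bar>of_int D\<bar> * (\<Prod>i<r. C i)"
  have R0: "R \<ge> 0" unfolding R_def
    using C(1) by (intro mult_nonneg_nonneg prod_nonneg) (auto intro: order_trans[of 0 1])
  define b where "b = \<lceil>(1 + R) ^ d\<rceil>"
  let ?Z = "{z :: 'a. \<exists>p. p \<noteq> 0 \<and> degree p \<le> d \<and> (\<forall>i. \<bar>coeff p i\<bar> \<le> b) \<and> poly (of_int_poly p) z = 0}"
  have "?Y \<subseteq> (\<lambda>z. z / of_int D) ` ?Z"
  proof
    fix y assume "y \<in> ?Y"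
    then obtain m k where m: "m > 0" "\<And>i. i < r \<Longrightarrow> k i < m"
      "y ^ m = (\<Prod>i<r. g i ^ k i)" by blast
    define z where "z = of_int D * y"
    \<comment> \<open>Because \<open>k i < m\<close>, the power \<open>D ^ m\<close> contains enough
      factors \<open>N i\<close> to turn each \<open>g i\<close> into the multiplier
      \<open>N i * g i\<close>; what remains is an integer.\<close>
    have "z ^ m = (\<Prod>i<r. of_int (N i ^ (m - k i)) * (of_int (N i) * g i) ^ k i)"
    proof -
      have "z ^ m = (\<Prod>i<r. of_int (N i) ^ m * g i ^ k i)"
        by (simp add: z_def D_def power_mult_distrib m(3) prod_power_distrib prod.distrib)
      also have "\<dots> = (\<Prod>i<r. of_int (N i ^ (m - k i)) * (of_int (N i) * g i) ^ k i)"
      proof (intro prod.cong refl)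
        fix i assume "i \<in> {..<r}"
        then have "m = (m - k i) + k i" using m(2)[of i] by simp
        then have "of_int (N i) ^ m = of_int (N i) ^ (m - k i) * (of_int (N i) ^ k i :: 'a)"
          by (metis power_add)
        then show "of_int (N i) ^ m * g i ^ k i = of_int (N i ^ (m - k i)) * (of_int (N i) * g i) ^ k i"
          by (simp add: power_mult_distrib)
      qed
      finally show ?thesis .
    qed
    then have "multiplier e d (z ^ m)"
      by (metis (no_types, lifting) multiplier_prod multiplier_mult[OF multiplier_of_int multiplier_power[OF N(2)]])
    then obtain Q :: "int poly" where Q: "lead_coeff Q = 1" "poly (of_int_poly Q) (z ^ m) = 0"
      using multiplier_integral[of e d "z ^ m" i0] i0 by blast
    \<comment> \<open>Substituting \<open>X ^ m\<close> turns the integral equation of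
      \<open>z ^ m\<close> into one for \<open>z\<close>. Its degree grows with \<open>m\<close>,
      but the minimal polynomial extracted from it has degree at most \<open>d\<close>.\<close>
    define Q' where "Q' = Q \<circ>\<^sub>p monom 1 m"
    have "lead_coeff Q' = 1"
      using Q(1) m(1) unfolding Q'_def by (subst lead_coeff_comp) (simp_all add: degree_monom_eq)
    moreover have "poly (of_int_poly Q') z = 0"
      using Q(2) by (simp add: Q'_def of_int_hom.map_poly_pcompose poly_pcompose poly_monom hom_distribs)
    ultimately obtain p :: "int poly" where p: "lead_coeff p = 1" "poly (of_int_poly p) z = 0"
      "\<And>q. q \<noteq> 0 \<Longrightarrow> poly (of_int_poly q) z = 0 \<Longrightarrow> degree p \<le> degree q"
      using integral_minimal_polynomial by blast
    have p0: "p \<noteq> 0" using p(1) by auto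
    then have pmin: "int_minimal p (of_int D * y)" using p by (simp add: int_minimal_def z_def)
    have deg: "degree p \<le> d" using algebraic_degree_bound[of e d, OF span i0, of z] p(3)
      by (meson order_trans)
    have roots: "cmod x \<le> R" if "poly (of_int_poly p) x = 0" for x
      unfolding R_def using conjugate_bound[OF pmin that, of r P g C m k] P C m by blast
    have "\<bar>coeff p i\<bar> \<le> b" for i
    proof -
      have "cmod (coeff (of_int_poly p) i) \<le> (1 + R) ^ degree (of_int_poly p :: complex poly)"
        using p(1) roots R0 by (intro coeff_bound_of_roots) auto
      then have "\<bar>of_int (coeff p i)\<bar> \<le> (1 + R) ^ degree p" by simp
      also have "\<dots> \<le> (1 + R) ^ d" using R0 deg by (intro power_increasing) auto
      finally show ?thesis unfolding b_def by linarith
    qed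
    then have "z \<in> ?Z" using p0 deg p(2) by blast
    moreover have "y = z / of_int D" using D by (simp add: z_def)
    ultimately show "y \<in> (\<lambda>z. z / of_int D) ` ?Z" by blast
  qed
  moreover have "finite ?Z" by (rule finite_roots_of_bounded_int_polys)
  ultimately show ?thesis by (meson finite_imageI finite_subset)
qed

section \<open>Multiplicative spans\<close>

definition mprod :: "nat \<Rightarrow> (nat \<Rightarrow> 'a::field) \<Rightarrow> (nat \<Rightarrow> int) \<Rightarrow> 'a"
  where "mprod r B k = (\<Prod>i<r. B i powi k i)"

definition mspan :: "nat \<Rightarrow> (nat \<Rightarrow> 'a::field) \<Rightarrow> 'a set"
  where "mspan r B = range (mprod r B)"

text \<open>The isolator of \<open>mspan r B\<close>: all its radicals in the field, including all
  roots of unity.\<close>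

definition msat :: "nat \<Rightarrow> (nat \<Rightarrow> 'a::field) \<Rightarrow> 'a set"
  where "msat r B = {y. y \<noteq> 0 \<and> (\<exists>n>0. y ^ n \<in> mspan r B)}"

definition root_of_unity :: "'a::field \<Rightarrow> bool"
  where "root_of_unity t \<longleftrightarrow> (\<exists>n>0. t ^ n = 1)"

lemma mprod_nonzero: "(\<And>i. i < r \<Longrightarrow> B i \<noteq> 0) \<Longrightarrow> mprod r B k \<noteq> 0"
  by (simp add: mprod_def)

lemma mprod_zero [simp]: "mprod r B (\<lambda>i. 0) = 1"
  by (simp add: mprod_def)

lemma mprod_cong:
  "(\<And>i. i < r \<Longrightarrow> B i = B' i) \<Longrightarrow> (\<And>i. i < r \<Longrightarrow> k i = k' i) \<Longrightarrow> mprod r B k = mprod r B' k'"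
  by (simp add: mprod_def)

lemma mprod_add:
  "(\<And>i. i < r \<Longrightarrow> B i \<noteq> 0) \<Longrightarrow> mprod r B (\<lambda>i. k i + k' i) = mprod r B k * mprod r B k'"
  by (simp add: mprod_def power_int_add prod.distrib)

lemma mprod_diff:
  "(\<And>i. i < r \<Longrightarrow> B i \<noteq> 0) \<Longrightarrow> mprod r B (\<lambda>i. k i - k' i) = mprod r B k / mprod r B k'"
  by (simp add: mprod_def power_int_diff prod_dividef)

lemma prod_power_int: "(\<Prod>i\<in>A. f i :: 'a::field) powi c = (\<Prod>i\<in>A. f i powi c)"
  by (induction A rule: infinite_finite_induct) (simp_all add: power_int_mult_distrib)

lemma power_power_int_swap: "((x::'a::field) powi c) ^ n = (x ^ n) powi c"
  unfolding power_int_power power_int_power' by (simp only: mult.commute)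

lemma mprod_scale: "mprod r B (\<lambda>i. c * k i) = mprod r B k powi c"
  by (simp add: mprod_def prod_power_int power_int_mult mult.commute[of c])

lemma mprod_power: "mprod r B k ^ n = mprod r B (\<lambda>i. int n * k i)"
  by (simp add: mprod_scale)

lemma mprod_unit:
  assumes "i < r" shows "mprod r B (\<lambda>j. if j = i then 1 else 0) = B i"
proof -
  have "mprod r B (\<lambda>j. if j = i then 1 else 0) = (\<Prod>j<r. if j = i then B j else 1)"
    unfolding mprod_def by (intro prod.cong) auto
  then show ?thesis using assms by simp
qed

lemma mprod_mult_base: "mprod r (\<lambda>i. a i * b i) k = mprod r a k * mprod r b k"
  by (simp add: mprod_def power_int_mult_distrib prod.distrib)

lemma mprod_power_base: "mprod r (\<lambda>i. B i ^ n i) k = mprod r B (\<lambda>i. int (n i) * k i)"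
  by (simp add: mprod_def power_int_mult)

text \<open>Closure conditions stand in for a subgroup predicate, so that the lemma serves spans,
  generated subgroups, \<open>G\<close> and groups of roots of unity alike.\<close>

lemma mprod_in_closed:
  assumes "1 \<in> S" "\<And>x y. x \<in> S \<Longrightarrow> y \<in> S \<Longrightarrow> x * y \<in> S"
    "\<And>x c. x \<in> S \<Longrightarrow> x powi c \<in> S"
    and "\<And>i. i < r \<Longrightarrow> h i \<in> S"
  shows "mprod r h k \<in> S"
proof -
  have "(\<Prod>i\<in>A. h i powi k i) \<in> S" if "finite A" "A \<subseteq> {..<r}" for A
    using that by induction (auto intro!: assms)
  then show ?thesis unfolding mprod_def by blast
qed

lemma mprod_in_mspan [simp]: "mprod r B k \<in> mspan r B"
  by (simp add: mspan_def)

lemma base_in_mspan: "i < r \<Longrightarrow> B i \<in> mspan r B"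
  by (metis mprod_unit mprod_in_mspan)

lemma one_in_mspan: "1 \<in> mspan r B"
  by (metis mprod_zero mprod_in_mspan)

lemma mspan_mult:
  assumes "\<And>i. i < r \<Longrightarrow> B i \<noteq> 0" "x \<in> mspan r B" "y \<in> mspan r B"
  shows "x * y \<in> mspan r B"
  using assms by (auto simp: mspan_def simp flip: mprod_add)

lemma mspan_power_int: "x \<in> mspan r B \<Longrightarrow> x powi c \<in> mspan r B"
  by (auto simp: mspan_def simp flip: mprod_scale)

lemma mspan_inverse: "x \<in> mspan r B \<Longrightarrow> inverse x \<in> mspan r B"
  using mspan_power_int[of x r B "-1"] by (simp add: power_int_minus)

lemma mspan_nonzero: "(\<And>i. i < r \<Longrightarrow> B i \<noteq> 0) \<Longrightarrow> x \<in> mspan r B \<Longrightarrow> x \<noteq> 0"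
  using mprod_nonzero[of r B] by (auto simp: mspan_def)

lemma mspan_minimal:
  assumes "\<And>i. i < r \<Longrightarrow> B i \<noteq> 0"
    "\<And>i. i < r \<Longrightarrow> h i \<in> mspan r B"
  shows "mspan r h \<subseteq> mspan r B"
proof -
  have "mprod r h k \<in> mspan r B" for k
    by (intro mprod_in_closed mspan_mult mspan_power_int one_in_mspan assms)
  then show ?thesis by (auto simp: mspan_def)
qed

section \<open>Generated subgroups as sets of power products\<close>

lemma inv_unit_group:
  assumes "(x::'a::field) \<noteq> 0" shows "inv\<^bsub>unit_group\<^esub> x = inverse x"
proof -
  interpret group "unit_group :: 'a monoid" by (rule group_unit_group)
  show ?thesis
    using assms by (intro inv_equality) (simp_all add: ring_of_type_algebra_def)
qed

lemma generate_eq_mspan: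
  assumes "\<And>i. i < r \<Longrightarrow> B i \<noteq> (0::'a::field)"
  shows "generate unit_group (B ` {..<r}) = mspan r B"
proof -
  interpret group "unit_group :: 'a monoid" by (rule group_unit_group)
  note inv = inv_unit_group
  have nz: "\<And>x. x \<in> mspan r B \<Longrightarrow> x \<noteq> 0" using mspan_nonzero assms by blast
  have sub: "subgroup (mspan r B) unit_group"
  proof (rule subgroupI)
    show "mspan r B \<subseteq> carrier unit_group" unfolding unit_group_simps using nz by blast
    show "mspan r B \<noteq> {}" by (simp add: mspan_def)
    show "inv\<^bsub>unit_group\<^esub> x \<in> mspan r B" if "x \<in> mspan r B" for x
      using inv[OF nz[OF that]] mspan_inverse[OF that] by simp
    show "x \<otimes>\<^bsub>unit_group\<^esub> y \<in> mspan r B" if "x \<in> mspan r B" "y \<in> mspan r B" for x y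
      unfolding unit_group_simps by (intro mspan_mult assms that)
  qed
  have "generate unit_group (B ` {..<r}) \<subseteq> mspan r B"
    by (intro generate_subgroup_incl[OF _ sub]) (auto intro: base_in_mspan)
  moreover have "mspan r B \<subseteq> generate unit_group (B ` {..<r})"
  proof -
    let ?S = "generate unit_group (B ` {..<r})"
    have carr: "B ` {..<r} \<subseteq> carrier unit_group" unfolding unit_group_simps using assms by auto
    have g: "subgroup ?S unit_group" by (rule generate_is_subgroup[OF carr])
    have mult: "x * y \<in> ?S" if "x \<in> ?S" "y \<in> ?S" for x y
      using subgroup.m_closed[OF g that] unfolding unit_group_simps .
    have one: "1 \<in> ?S" using subgroup.one_closed[OF g] unfolding unit_group_simps .
    have nz': "x \<noteq> 0" if "x \<in> ?S" for x using subgroup.subset[OF g] that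
      unfolding unit_group_simps by auto
    have pow: "x ^ n \<in> ?S" if "x \<in> ?S" for x n by (induction n) (auto intro: one mult that)
    have inv': "inverse x \<in> ?S" if "x \<in> ?S" for x
        using subgroup.m_inv_closed[OF g that] inv[OF nz'[OF that]] by simp
    have "x powi c \<in> ?S" if "x \<in> ?S" for x c
      using pow inv' that by (simp add: power_int_def)
    then have "mprod r B k \<in> ?S" for k
      by (intro mprod_in_closed one mult) (auto intro: generate.incl)
    then show ?thesis by (auto simp: mspan_def)
  qed
  ultimately show ?thesis by blast
qed

section \<open>Exchanging one generator\<close>

lemma mprod_remove:
  "i < r \<Longrightarrow> mprod r B k = B i powi k i * (\<Prod>j\<in>{..<r} - {i}. B j powi k j)"
  by (simp add: mprod_def prod.remove)

text \<open>As \<open>x i = 1\<close>, the relation can be solved for \<open>B i\<close>, namely as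
  \<open>y ^ q\<close> divided by \<open>t\<close> and by the powers \<open>B j powi x j\<close> of
  the other elements. Substituting this into the product gives the new exponents.\<close>

lemma mprod_exchange:
  assumes nz: "\<And>i. i < r \<Longrightarrow> B i \<noteq> 0" and i: "i < r" and "y \<noteq> 0"
    "t \<noteq> 0"
    and y: "y ^ q = t * mprod r B x" and x: "x i = 1"
  shows "mprod r B k = inverse t powi k i *
    mprod r (B(i := y)) (\<lambda>j. if j = i then int q * k i else k j - k i * x j)"
proof -
  define P where "P k = (\<Prod>j\<in>{..<r} - {i}. B j powi k j)" for k
  have Pnz: "P k \<noteq> 0" for k using nz by (auto simp: P_def)
  have Bi: "B i = y ^ q * inverse t * inverse (P x)"
    using y assms(4) Pnz[of x] mprod_remove[OF i, of B x] x unfolding P_def[symmetric]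
    by (simp add: field_simps)
  have 1: "(\<Prod>j\<in>{..<r} - {i}. (B(i := y)) j powi (if j = i then int q * k i else k j - k i * x j)) =
    P k * inverse (P x) powi k i"
  proof -
    have "(\<Prod>j\<in>{..<r} - {i}. (B(i := y)) j powi (if j = i then int q * k i else k j - k i * x j)) =
      (\<Prod>j\<in>{..<r} - {i}. B j powi k j * inverse (B j powi x j) powi k i)"
    proof (intro prod.cong refl)
      fix j assume "j \<in> {..<r} - {i}"
      then have "j \<noteq> i" "B j \<noteq> 0" using nz by auto
      moreover have "B j powi (k i * x j) = (B j powi x j) powi k i"
        by (metis power_int_mult mult.commute)
      ultimately show "(B(i := y)) j powi (if j = i then int q * k i else k j - k i * x j) =
        B j powi k j * inverse (B j powi x j) powi k i"
        by (simp add: power_int_diff power_int_inverse divide_inverse)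
    qed
    also have "\<dots> = P k * inverse (P x) powi k i"
      unfolding P_def prod.distrib prod_power_int[symmetric] prod_inversef[symmetric] comp_def ..
    finally show ?thesis .
  qed
  have 2: "y powi (int q * k i) = (y ^ q) powi k i" by (simp add: power_int_mult)
  have "mprod r B k = B i powi k i * P k" using mprod_remove[OF i] by (simp add: P_def)
  also have "\<dots> = inverse t powi k i * (y powi (int q * k i) * (P k * inverse (P x) powi k i))"
    unfolding Bi 2 by (simp only: power_int_mult_distrib ac_simps)
  finally show ?thesis unfolding mprod_remove[OF i, of "B(i := y)"] 1 by simp
qed

text \<open>The exchange with \<open>q = 1\<close> and \<open>t = 1\<close>; it is reversible
  because the exponent at \<open>i\<close> is 1.\<close>

lemma mspan_unimodular:
  assumes nz: "\<And>i. i < r \<Longrightarrow> B i \<noteq> 0" and i: "i < r" and x: "x i = 1"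
  shows "mspan r (B(i := mprod r B x)) = mspan r B"
proof
  have y: "mprod r B x \<noteq> 0" using nz mprod_nonzero by blast
  show "mspan r (B(i := mprod r B x)) \<subseteq> mspan r B"
    by (intro mspan_minimal nz) (auto intro: base_in_mspan)
  have "mprod r B k \<in> mspan r (B(i := mprod r B x))" for k
    by (subst mprod_exchange[OF nz i y, where t=1 and q=1 and x=x]) (auto simp: x)
  then show "mspan r B \<subseteq> mspan r (B(i := mprod r B x))" by (auto simp: mspan_def)
qed

section \<open>Roots of unity and independence modulo torsion\<close>

lemma root_of_unity_nonzero: "root_of_unity t \<Longrightarrow> t \<noteq> 0"
  by (auto simp: root_of_unity_def power_0_left)

lemma root_of_unity_1: "root_of_unity 1"
  by (auto simp: root_of_unity_def)

lemma root_of_unity_mult: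
  assumes "root_of_unity s" "root_of_unity t" shows "root_of_unity (s * t)"
proof -
  obtain m n where "m > 0" "n > 0" "s ^ m = 1" "t ^ n = 1"
    using assms by (auto simp: root_of_unity_def)
  moreover have "(s * t) ^ (m * n) = (s ^ m) ^ n * (t ^ n) ^ m"
    by (simp only: power_mult_distrib mult.commute[of n m] flip: power_mult)
  ultimately have "(s * t) ^ (m * n) = 1" by simp
  with \<open>m > 0\<close> \<open>n > 0\<close> show ?thesis unfolding root_of_unity_def
    by (intro exI[of _ "m * n"]) simp
qed

lemma root_of_unity_power_int:
  assumes "root_of_unity t" shows "root_of_unity (t powi c)"
proof -
  obtain n where "n > 0" "t ^ n = 1" using assms by (auto simp: root_of_unity_def)
  then have "(t powi c) ^ n = 1" by (simp add: power_power_int_swap)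
  with \<open>n > 0\<close> show ?thesis by (auto simp: root_of_unity_def)
qed

lemma mult_independent_root_of_unity:
  assumes "mult_independent r B" "root_of_unity (mprod r B k)" "i < r"
  shows "k i = 0"
proof -
  obtain n where n: "n > 0" "mprod r B k ^ n = 1" using assms by (auto simp: root_of_unity_def)
  then have "mprod r B (\<lambda>i. int n * k i) = 1" by (simp add: mprod_power)
  then have "\<forall>i<r. int n * k i = 0" using assms(1) unfolding mult_independent_def mprod_def by fast
  then have "int n * k i = 0" using assms(3) by blast
  with n show ?thesis by simp
qed

lemma mult_independent_unique:
  assumes nz: "\<And>i. i < r \<Longrightarrow> B i \<noteq> 0"
    and "mult_independent r B" "mprod r B k = t * mprod r B k'" "root_of_unity t" "i < r"
  shows "k i = k' i"
proof -
  have "mprod r B k' \<noteq> 0" using nz mprod_nonzero by blast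
  then have "mprod r B (\<lambda>i. k i - k' i) = t" using assms by (simp add: mprod_diff)
  then have "k i - k' i = 0"
    using mult_independent_root_of_unity[of r B "\<lambda>i. k i - k' i" i] assms by simp
  then show ?thesis by simp
qed

text \<open>The \<open>q\<close>-th power of a relation among the new elements is, up to a root of
  unity, a power product of the old ones, whose exponents must all vanish.\<close>

lemma mult_independent_exchange:
  assumes nz: "\<And>i. i < r \<Longrightarrow> B i \<noteq> 0" and i: "i < r" and ynz: "y \<noteq> 0"
    and t: "root_of_unity t"
    and y: "y ^ q = t * mprod r B x" and x: "x i = 1" and q: "q > 0" and ind: "mult_independent r B"
  shows "mult_independent r (B(i := y))"
  unfolding mult_independent_def
proof (intro allI impI)
  fix k j assume k: "(\<Prod>j<r. (B(i := y)) j powi k j) = 1" and j: "j < r"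
  \<comment> \<open>Chosen so that exchanging \<open>B i\<close> for \<open>y\<close> turns the
    exponents \<open>m\<close> into exactly \<open>q\<close> times \<open>k\<close>.\<close>
  define m where "m = (\<lambda>j. if j = i then k i else int q * k j + k i * x j)"
  have "mprod r B m = inverse t powi k i *
     mprod r (B(i := y)) (\<lambda>j. if j = i then int q * m i else m j - m i * x j)"
    using mprod_exchange[OF nz i ynz _ y x, of m] root_of_unity_nonzero[OF t] by (simp add: m_def)
  also have "(\<lambda>j. if j = i then int q * m i else m j - m i * x j) = (\<lambda>j. int q * k j)"
    by (auto simp: m_def)
  also have "mprod r (B(i := y)) (\<lambda>j. int q * k j) = 1"
    using k unfolding mprod_scale by (simp add: mprod_def)
  finally have "root_of_unity (mprod r B m)"
    using root_of_unity_power_int[OF t, of "- k i"] by (simp add: power_int_minus power_int_inverse)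
  then have m0: "m j = 0" if "j < r" for j using mult_independent_root_of_unity[OF ind] that by blast
  have "k i = 0" using m0[OF i] by (simp add: m_def)
  then show "k j = 0" using m0[OF j] q by (auto simp: m_def split: if_splits)
qed

text \<open>Prepares a relation for the exchange. Besides the exponent 1 at \<open>i\<close>,
  exponents divisible by \<open>q\<close> are made zero, so that later only indices with exponent
  prime to \<open>q\<close> have to be compared.\<close>

lemma normalise_relation:
  assumes nz: "\<And>i. i < r \<Longrightarrow> B i \<noteq> 0" and ynz: "y \<noteq> 0" and i: "i < r"
    and q: "prime q"
    and y: "y ^ q = t * mprod r B x" and x: "\<not> int q dvd x i"
  obtains u w x' where "(y powi u * mprod r B w) ^ q = t powi u * mprod r B x'" "x' i = 1"
    "\<And>j. int q dvd x j \<Longrightarrow> x' j = 0"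
proof -
  have "coprime (x i) (int q)"
    using prime_imp_coprime[of "int q" "x i"] q x by (simp add: coprime_commute)
  then obtain u v where uv: "u * x i + v * int q = 1"
    using bezout_int[of "x i" "int q"] by auto
  \<comment> \<open>The new exponents are \<open>u * x j + q * w j\<close>. At \<open>i\<close> the
    Bezout coefficient \<open>v\<close> makes this 1; where \<open>q\<close> divides
    \<open>x j\<close>, the quotient makes it 0; elsewhere nothing is changed beyond the factor
    \<open>u\<close>.\<close>
  define w where "w = (\<lambda>j. if j = i then v else if int q dvd x j then - (u * (x j div int q)) else 0)"
  define x' where "x' = (\<lambda>j. u * x j + int q * w j)"
  have "(y powi u * mprod r B w) ^ q = (y ^ q) powi u * mprod r B w ^ q"
    by (simp only: power_mult_distrib power_power_int_swap)
  also have "\<dots> = t powi u * mprod r B x'"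
    unfolding y x'_def using nz by (simp add: power_int_mult_distrib mprod_add mprod_scale)
  finally have "(y powi u * mprod r B w) ^ q = t powi u * mprod r B x'" .
  moreover have "x' i = 1" using uv by (simp add: x'_def w_def algebra_simps)
  moreover have "x' j = 0" if "int q dvd x j" for j
    using that x by (auto simp: x'_def w_def)
  ultimately show ?thesis using that by blast
qed

text \<open>Termination of both ascending chains: the measure is bounded on the admissible states,
  so one of them has maximal measure, and it satisfies \<open>Q\<close> because any failure would
  lead to a larger value.\<close>

lemma bounded_progress:
  fixes f :: "'s \<Rightarrow> nat"
  assumes "P s" "\<And>s. P s \<Longrightarrow> f s \<le> N"
    "\<And>s. P s \<Longrightarrow> \<not> Q s \<Longrightarrow> \<exists>s'. P s' \<and> f s < f s'"
  shows "\<exists>s. P s \<and> Q s"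
proof -
  have "\<forall>s. P s \<longrightarrow> f s < Suc N" using assms(2) by (simp add: le_imp_less_Suc)
  from ex_has_greatest_nat[OF assms(1) this]
  obtain x where x: "P x" "\<forall>y. P y \<longrightarrow> f y \<le> f x" by auto
  have "Q x"
  proof (rule ccontr)
    assume "\<not> Q x"
    from assms(3)[OF x(1) this] obtain y where "P y" "f x < f y" by auto
    then show False using x(2) by (simp add: leD)
  qed
  then show ?thesis using x(1) by auto
qed

text \<open>\<open>Y\<close> meets every coset of \<open>mspan r g\<close> in
  \<open>msat r g\<close>. Since \<open>H\<close> and \<open>H'\<close> are stable under
  \<open>mspan r g\<close>, the representative in \<open>Y\<close> of the new element
  \<open>y\<close> also lies in \<open>H'\<close> and not in \<open>H\<close>. This makes a count in
  \<open>Y\<close> a strict measure of growth.\<close>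

lemma card_Int_less:
  assumes "finite Y" and cover: "msat r g \<subseteq> {h * y | h y. h \<in> mspan r g \<and> y \<in> Y}"
    and nz: "\<And>i. i < r \<Longrightarrow> g i \<noteq> 0"
    and "H \<subseteq> H'" and H:
      "\<And>h z. h \<in> mspan r g \<Longrightarrow> z \<in> H \<Longrightarrow> h * z \<in> H"
    and H': "\<And>h z. h \<in> mspan r g \<Longrightarrow> z \<in> H' \<Longrightarrow> h * z \<in> H'"
    and y: "y \<in> msat r g" "y \<in> H'" "y \<notin> H"
  shows "card (H \<inter> Y) < card (H' \<inter> Y)"
proof -
  obtain h z where z: "y = h * z" "h \<in> mspan r g" "z \<in> Y" using cover y by blast
  have "h \<noteq> 0" using mspan_nonzero nz z by blast
  then have "z = inverse h * y" using z by simp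
  then have "z \<in> H'" using H' y mspan_inverse z by metis
  moreover have "z \<notin> H" using H y z by blast
  ultimately have "H \<inter> Y \<subset> H' \<inter> Y"
    using \<open>H \<subseteq> H'\<close> \<open>z \<in> Y\<close> by blast
  then show ?thesis using \<open>finite Y\<close> by (simp add: psubset_card_mono)
qed

section \<open>Exchange arguments\<close>

text \<open>First chain: an independent family in \<open>G\<close> is enlarged by exchanges until it
  generates \<open>G\<close>. Torsion-freeness excludes the one case in which no exchange is
  available.\<close>

lemma free_basis:
  fixes G :: "'a::field set"
  assumes Y: "finite Y" "msat r g \<subseteq> {h * y | h y. h \<in> mspan r g \<and> y \<in> Y}"
    and one: "1 \<in> G" and mult:
      "\<And>x y. x \<in> G \<Longrightarrow> y \<in> G \<Longrightarrow> x * y \<in> G"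
    and pow: "\<And>x c. x \<in> G \<Longrightarrow> x powi c \<in> G" and nzG: "0 \<notin> G"
    and tf: "torsion_free G" and gG: "\<And>i. i < r \<Longrightarrow> g i \<in> G" and ind:
      "mult_independent r g"
    and sat: "G \<subseteq> msat r g"
  shows "\<exists>g'. (\<forall>i<r. g' i \<in> G) \<and> mult_independent r g' \<and> mspan r g' = G"
proof -
  define P where "P g' \<longleftrightarrow> (\<forall>i<r. g' i \<in> G) \<and> mult_independent r g' \<and> mspan r g \<subseteq> mspan r g'" for g'
  have spanG: "mspan r g' \<subseteq> G" if "\<And>i. i < r \<Longrightarrow> g' i \<in> G" for g'
  proof -
    have "mprod r g' k \<in> G" for k by (intro mprod_in_closed one mult pow that)
    then show ?thesis by (auto simp: mspan_def)
  qed
  have "\<exists>g'. P g' \<and> mspan r g' = G"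
  proof (rule bounded_progress[where f = "\<lambda>g'. card (mspan r g' \<inter> Y)" and N = "card Y" and P = P])
    show "P g" using gG ind by (simp add: P_def)
    show "card (mspan r g' \<inter> Y) \<le> card Y" for g' by (intro card_mono Y) simp
    fix b assume "P b" and ne: "mspan r b \<noteq> G"
    then have bG: "\<And>i. i < r \<Longrightarrow> b i \<in> G" and bind: "mult_independent r b"
      and gb: "mspan r g \<subseteq> mspan r b"
      by (auto simp: P_def)
    have bnz: "b i \<noteq> 0" if "i < r" for i using bG[OF that] nzG by metis
    have gnz: "g i \<noteq> 0" if "i < r" for i using gG[OF that] nzG by metis
    obtain x where x: "x \<in> G" "x \<notin> mspan r b" using ne spanG[of b] bG by blast
    \<comment> \<open>By minimality of \<open>n\<close>, removing a prime factor \<open>q\<close>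
      gives a power \<open>z\<close> of \<open>x\<close> outside the span whose \<open>q\<close>-th
      power lies inside.\<close>
    define n where "n = (LEAST n. n > 0 \<and> x ^ n \<in> mspan r b)"
    have ex: "\<exists>n. n > 0 \<and> x ^ n \<in> mspan r b" using x(1) sat gb by (auto simp: msat_def)
    have n: "n > 0" "x ^ n \<in> mspan r b" using LeastI_ex[OF ex] by (auto simp: n_def)
    have "n \<noteq> 1" using n x by auto
    then obtain q where q: "prime q" "q dvd n" using prime_factor_nat by blast
    then obtain m where m: "n = m * q" by (auto simp: mult.commute)
    have "m > 0" "m < n" using n(1) m q(1) prime_gt_1_nat[OF q(1)] by auto
    define z where "z = x ^ m"
    have zb: "z \<notin> mspan r b"
      using not_less_Least[of m "\<lambda>n. n > 0 \<and> x ^ n \<in> mspan r b"] \<open>m > 0\<close> \<open>m < n\<close> by (auto simp: z_def n_def)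
    have zG: "z \<in> G" using pow[OF x(1), of "int m"] by (simp add: z_def)
    then have znz: "z \<noteq> 0" using nzG by metis
    have "z ^ q \<in> mspan r b" using n(2) by (simp add: z_def m power_mult)
    then obtain a where a: "z ^ q = mprod r b a" by (auto simp: mspan_def)
    have q0: "q > 0" using q(1) prime_gt_0_nat by blast
    \<comment> \<open>If \<open>q\<close> divided all exponents, \<open>z\<close> would differ from
      an element \<open>c\<close> of the span by a \<open>q\<close>-th root of unity in
      \<open>G\<close>, and so equal it.\<close>
    have "\<exists>i<r. \<not> int q dvd a i"
    proof (rule ccontr)
      assume "\<not> ?thesis"
      then have "mprod r b a = mprod r b (\<lambda>i. int q * (a i div int q))" by (intro mprod_cong) auto
      also have "\<dots> = mprod r b (\<lambda>i. a i div int q) ^ q" by (simp only: mprod_power)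
      finally have eq: "z ^ q = mprod r b (\<lambda>i. a i div int q) ^ q" using a by simp
      define c where "c = mprod r b (\<lambda>i. a i div int q)"
      have c: "c \<in> mspan r b" "c \<noteq> 0" using bnz by (auto simp: c_def mprod_nonzero)
      have "z * c powi (-1) \<in> G" using c spanG[of b] bG by (intro mult pow zG) auto
      moreover have "(z * c powi (-1)) ^ q = 1" using eq c by (simp add: power_int_minus field_simps c_def)
      ultimately have "z * c powi (-1) = 1" using tf q0 unfolding torsion_free_def by blast
      then have "z = c" using c by (simp add: power_int_minus field_simps)
      then show False using zb c by simp
    qed
    then obtain i where i: "i < r" "\<not> int q dvd a i" by blast
    have "z ^ q = 1 * mprod r b a" using a by simp
    from normalise_relation[OF bnz znz i(1) q(1) this i(2)]
    obtain u w a' where rel: "(z powi u * mprod r b w) ^ q = 1 powi u * mprod r b a'" and a'i: "a' i = 1"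
      by metis
    define y where "y = z powi u * mprod r b w"
    have y: "y ^ q = 1 * mprod r b a'" using rel by (simp add: y_def)
    have yG: "y \<in> G" unfolding y_def using spanG[of b] bG by (intro mult pow zG) auto
    then have ynz: "y \<noteq> 0" using nzG by metis
    define b' where "b' = b(i := y)"
    have b'G: "b' j \<in> G" if "j < r" for j using that bG yG by (simp add: b'_def)
    have b'nz: "b' j \<noteq> 0" if "j < r" for j using b'G[OF that] nzG by metis
    have b'ind: "mult_independent r b'" unfolding b'_def
      by (rule mult_independent_exchange[OF bnz i(1) ynz root_of_unity_1 y a'i q0 bind])
    have sub: "mspan r b \<subseteq> mspan r b'"
    proof -
      have "mprod r b k \<in> mspan r b'" for k
        by (subst mprod_exchange[OF bnz i(1) ynz _ y a'i]) (auto simp: b'_def)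
      then show ?thesis by (auto simp: mspan_def)
    qed
    \<comment> \<open>Otherwise uniqueness of exponents would make the exponent 1 at
      \<open>i\<close> a multiple of \<open>q\<close>.\<close>
    have "y \<notin> mspan r b"
    proof
      assume "y \<in> mspan r b"
      then obtain c where "y = mprod r b c" by (auto simp: mspan_def)
      then have "mprod r b a' = 1 * mprod r b (\<lambda>j. int q * c j)" using y by (simp add: mprod_scale)
      from mult_independent_unique[OF bnz bind this root_of_unity_1 i(1)]
      have "int q * c i = 1" using a'i by simp
      then show False using prime_gt_1_nat[OF q(1)] by (simp add: zmult_eq_1_iff)
    qed
    moreover have "y \<in> mspan r b'" using base_in_mspan[OF i(1), of b'] by (simp add: b'_def)
    ultimately have "card (mspan r b \<inter> Y) < card (mspan r b' \<inter> Y)"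
      using sub gb yG sat mspan_mult[of r b, OF bnz] mspan_mult[of r b', OF b'nz]
      by (intro card_Int_less[OF Y gnz, where y = y]) auto
    moreover have "P b'" using b'G b'ind gb sub by (auto simp: P_def)
    ultimately show "\<exists>b'. P b' \<and> card (mspan r b \<inter> Y) < card (mspan r b' \<inter> Y)" by blast
  qed
  then show ?thesis by (auto simp: P_def)
qed

lemma unit_ord_eq_prime_power:
  assumes "prime l" "t ^ (l ^ k) = (1::'a::field)"
  shows "\<exists>h. unit_ord t = l ^ h"
proof -
  interpret group "unit_group :: 'a monoid" by (rule group_unit_group)
  have "t \<noteq> 0" using assms by (auto simp: power_0_left prime_gt_0_nat)
  then have "t \<in> carrier unit_group" unfolding unit_group_simps by simp
  then have "unit_ord t dvd l ^ k"
    using pow_eq_id[of t "l ^ k"] assms(2) unfolding unit_group_pow unit_group_simps by simp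
  then show ?thesis using divides_primepow_nat[OF assms(1)] by blast
qed

lemma power_unit_ord_eq_1: "t \<noteq> 0 \<Longrightarrow> t ^ unit_ord t = (1::'a::field)"
proof -
  interpret group "unit_group :: 'a monoid" by (rule group_unit_group)
  assume "t \<noteq> 0"
  then have "t \<in> carrier unit_group" unfolding unit_group_simps by simp
  from pow_ord_eq_1[OF this] show ?thesis unfolding unit_group_pow unit_group_simps .
qed

text \<open>Second chain, on triples \<open>(B, d, \<zeta>)\<close>. The span of the generators
  never changes, so progress is measured on \<open>H B\<close>, the elements lying in
  \<open>mspan r B\<close> up to a root of unity; it grows strictly when \<open>y\<close> replaces
  \<open>B i\<close>.\<close>

lemma strongly_independent_generators:
  fixes g :: "nat \<Rightarrow> 'a::field"
  assumes Y: "finite Y" "msat r g \<subseteq> {h * y | h y. h \<in> mspan r g \<and> y \<in> Y}"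
    and gnz: "\<And>i. i < r \<Longrightarrow> g i \<noteq> 0" and ind: "mult_independent r g" and l:
      "prime l"
  shows "\<exists>B d \<zeta>. strongly_independent l r B \<and> (\<forall>i<r. \<exists>k. \<zeta> i ^ (l ^ k) = 1) \<and>
    mspan r (\<lambda>i. B i ^ (l ^ d i) * \<zeta> i) = mspan r g"
proof -
  have l0: "l > 0" using l prime_gt_0_nat by blast
  \<comment> \<open>Asking for some exponent \<open>l ^ k\<close> instead of an exact order makes
    closure under products and powers direct.\<close>
  define L where "L = {t::'a. \<exists>k. t ^ (l ^ k) = 1}"
  have L_one: "1 \<in> L" by (auto simp: L_def)
  have L_mult: "s * t \<in> L" if st: "s \<in> L" "t \<in> L" for s t
  proof -
    obtain j k where "s ^ (l ^ j) = 1" "t ^ (l ^ k) = 1" using st unfolding L_def by blast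
    then have "(s ^ (l ^ j)) ^ (l ^ k) * (t ^ (l ^ k)) ^ (l ^ j) = 1" by simp
    then have "(s * t) ^ (l ^ (j + k)) = 1"
      by (simp only: power_mult_distrib power_add mult.commute[of "l ^ k"] flip: power_mult)
    then show ?thesis by (auto simp: L_def)
  qed
  have L_pow: "t powi c \<in> L" if "t \<in> L" for t c
    using that unfolding L_def mem_Collect_eq power_power_int_swap by (metis power_int_1_left)
  have L_ru: "root_of_unity t" if "t \<in> L" for t
    using that l0 unfolding L_def root_of_unity_def mem_Collect_eq by (metis zero_less_power)
  define gen where "gen B d \<zeta> = (\<lambda>i. B i ^ (l ^ d i) * \<zeta> i)" for B \<zeta> :: "nat \<Rightarrow> 'a" and d
  define P where "P s \<longleftrightarrow> (case s of (B, d, \<zeta>) \<Rightarrow> (\<forall>i<r. B i \<noteq> 0) \<and> mult_independent r B \<and>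
    (\<forall>i<r. \<zeta> i \<in> L) \<and> mspan r (gen B d \<zeta>) = mspan r g)" for s
  define H where "H B = {z. \<exists>t. root_of_unity t \<and> t * z \<in> mspan r B}" for B :: "nat \<Rightarrow> 'a"
  have "\<exists>s. P s \<and> strongly_independent l r (fst s)"
  proof (rule bounded_progress[where f = "\<lambda>s. card (H (fst s) \<inter> Y)" and N = "card Y" and P = P])
    show "P (g, \<lambda>_. 0, \<lambda>_. 1)" using gnz ind L_one by (simp add: P_def gen_def)
    show "card (H (fst s) \<inter> Y) \<le> card Y" for s :: "(nat \<Rightarrow> 'a) \<times> (nat \<Rightarrow> nat) \<times> (nat \<Rightarrow> 'a)"
      by (intro card_mono Y) simp
    fix s assume "P s" and nsi: "\<not> strongly_independent l r (fst s)"
    obtain B d \<zeta> where s: "s = (B, d, \<zeta>)" by (cases s) auto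
    have Bnz: "\<And>i. i < r \<Longrightarrow> B i \<noteq> 0" and Bind: "mult_independent r B" and
      \<zeta>L: "\<And>i. i < r \<Longrightarrow> \<zeta> i \<in> L"
        and span: "mspan r (gen B d \<zeta>) = mspan r g"
      using \<open>P s\<close> by (auto simp: P_def s)
    have gennz: "gen B d \<zeta> i \<noteq> 0" if "i < r" for i
      using that Bnz root_of_unity_nonzero[OF L_ru[OF \<zeta>L]] by (simp add: gen_def)
    obtain x where x: "\<not> (\<forall>i<r. int l dvd x i)" "\<not> strongly_indivisible l (mprod r B x)"
      using nsi Bnz by (auto simp: strongly_independent_def s mprod_def)
    then obtain \<xi> k v where \<xi>: "\<xi> \<noteq> 0" "unit_ord \<xi> = l ^ k" and v:
      "mprod r B x * \<xi> = v ^ l" "v \<noteq> 0"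
      using mprod_nonzero[of r B x] Bnz by (auto simp: strongly_indivisible_def)
    have \<xi>L: "\<xi> \<in> L" using power_unit_ord_eq_1[OF \<xi>(1)] \<xi>(2) by (auto simp: L_def)
    define I where "I = {i. i < r \<and> \<not> int l dvd x i}"
    have "finite I" "I \<noteq> {}" using x(1) by (auto simp: I_def)
    then obtain i where iI: "i \<in> I" and imax: "\<And>j. j \<in> I \<Longrightarrow> d j \<le> d i"
      using Max_in[of "d ` I"] Max_ge[of "d ` I"]
        by (metis (no_types) finite_imageI image_is_empty imageE imageI)
    then have i: "i < r" "\<not> int l dvd x i" by (auto simp: I_def)
    have "v ^ l = \<xi> * mprod r B x" using v by (simp add: mult.commute)
    from normalise_relation[OF Bnz v(2) i(1) l this i(2)]
    obtain u w a where rel: "(v powi u * mprod r B w) ^ l = \<xi> powi u * mprod r B a" and ai: "a i = 1"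
      and a0: "\<And>j. int l dvd x j \<Longrightarrow> a j = 0" by metis
    define y where "y = v powi u * mprod r B w"
    define t where "t = \<xi> powi u"
    have tL: "t \<in> L" using \<xi>L L_pow by (simp add: t_def)
    note tru = L_ru[OF tL]
    have tnz: "t \<noteq> 0" using root_of_unity_nonzero[OF tru] .
    have y: "y ^ l = t * mprod r B a" using rel by (simp add: y_def t_def)
    have ynz: "y \<noteq> 0" using v(2) mprod_nonzero[of r B w] Bnz by (simp add: y_def)
    \<comment> \<open>Raising the relation to the power \<open>l ^ d i\<close> expresses it in the
      generators, with exponents \<open>e\<close>. Maximality of \<open>d i\<close> makes
      \<open>l ^ (d i - d j)\<close> the correct factor wherever \<open>a j\<close> is nonzero, and
      \<open>e i = 1\<close> makes the change of generators unimodular.\<close>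
    define e where "e = (\<lambda>j. if a j = 0 then 0 else int (l ^ (d i - d j)) * a j)"
    have ei: "e i = 1" using ai by (simp add: e_def)
    have ej: "int (l ^ d j) * e j = int (l ^ d i) * a j" if "j < r" for j
    proof (cases "a j = 0")
      case False
      then have "j \<in> I" using a0 that by (auto simp: I_def)
      from imax[OF this] have "l ^ d i = l ^ d j * l ^ (d i - d j)" by (simp flip: power_add)
      then show ?thesis using False by (simp add: e_def)
    qed (simp add: e_def)
    \<comment> \<open>Collects the roots of unity left over when the product of the generators with
      exponents \<open>e\<close> is written as \<open>y ^ (l ^ Suc (d i))\<close> times a
      factor.\<close>
    define \<eta> where "\<eta> = mprod r \<zeta> e * inverse t ^ (l ^ d i)"
    define B' where "B' = B(i := y)"
    define d' where "d' = d(i := Suc (d i))"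
    define \<zeta>' where "\<zeta>' = \<zeta>(i := \<eta>)"
    have "mprod r (gen B d \<zeta>) e = mprod r B (\<lambda>j. int (l ^ d j) * e j) * mprod r \<zeta> e"
      unfolding gen_def mprod_mult_base mprod_power_base ..
    also have "mprod r B (\<lambda>j. int (l ^ d j) * e j) = mprod r B (\<lambda>j. int (l ^ d i) * a j)"
      using ej by (intro mprod_cong) auto
    also have "\<dots> = mprod r B a ^ (l ^ d i)" by (simp only: mprod_power)
    also have "mprod r B a = y ^ l * inverse t" using y tnz by simp
    also have "(y ^ l * inverse t) ^ (l ^ d i) * mprod r \<zeta> e = y ^ (l ^ Suc (d i)) * \<eta>"
      by (simp add: \<eta>_def power_mult_distrib power_mult)
    finally have "gen B' d' \<zeta>' = (gen B d \<zeta>)(i := mprod r (gen B d \<zeta>) e)"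
      by (auto simp: gen_def B'_def d'_def \<zeta>'_def fun_eq_iff)
    then have span': "mspan r (gen B' d' \<zeta>') = mspan r g"
      using mspan_unimodular[of r "gen B d \<zeta>" i e] gennz i(1) ei span by simp
    have "\<eta> \<in> L"
    proof -
      have "inverse t ^ (l ^ d i) \<in> L"
        using L_pow[OF L_pow[OF tL, of "-1"], of "int (l ^ d i)"]
        unfolding power_int_of_nat by (simp add: power_int_minus)
      then show ?thesis
        unfolding \<eta>_def by (intro L_mult mprod_in_closed L_one L_pow \<zeta>L)
    qed
    then have \<zeta>'L: "\<zeta>' j \<in> L" if "j < r" for j using \<zeta>L that
      by (simp add: \<zeta>'_def)
    have B'nz: "B' j \<noteq> 0" if "j < r" for j using that Bnz ynz by (simp add: B'_def)
    have B'ind: "mult_independent r B'" unfolding B'_def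
      by (rule mult_independent_exchange[OF Bnz i(1) ynz tru y ai l0 Bind])
    have P': "P (B', d', \<zeta>')" using B'nz B'ind \<zeta>'L span' by (simp add: P_def)
    \<comment> \<open>Elements of \<open>mspan r g\<close> are power products of \<open>C\<close> up
      to a factor in \<open>L\<close>, and \<open>H C\<close> absorbs both.\<close>
    have H_closed: "h * z \<in> H C" if C: "\<And>j. j < r \<Longrightarrow> C j \<noteq> 0"
      and hz: "\<And>j. j < r \<Longrightarrow> \<zeta>0 j \<in> L"
      "mspan r (gen C d0 \<zeta>0) = mspan r g" "h \<in> mspan r g" "z \<in> H C" for h z C d0 \<zeta>0
    proof -
      obtain k where "h = mprod r (gen C d0 \<zeta>0) k" using hz(2,3) by (auto simp: mspan_def)
      then have h: "h = mprod r C (\<lambda>j. int (l ^ d0 j) * k j) * mprod r \<zeta>0 k"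
        by (simp only: gen_def mprod_mult_base mprod_power_base)
      have zL: "mprod r \<zeta>0 k \<in> L" using hz(1) by (intro mprod_in_closed L_one L_mult L_pow)
      obtain t where t: "root_of_unity t" "t * z \<in> mspan r C" using hz(4) by (auto simp: H_def)
      have "root_of_unity (t * mprod r \<zeta>0 k powi (-1))"
        by (intro root_of_unity_mult t L_ru L_pow zL)
      moreover have "(t * mprod r \<zeta>0 k powi (-1)) * (h * z) = mprod r C (\<lambda>j. int (l ^ d0 j) * k j) * (t * z)"
        using root_of_unity_nonzero[OF L_ru[OF zL]] unfolding h by (simp add: power_int_minus field_simps)
      moreover have "mprod r C (\<lambda>j. int (l ^ d0 j) * k j) * (t * z) \<in> mspan r C"
        by (intro mspan_mult C mprod_in_mspan t)
      ultimately show ?thesis unfolding H_def mem_Collect_eq by metis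
    qed
    have HH': "H B \<subseteq> H B'"
    proof
      fix z assume "z \<in> H B"
      then obtain t1 k where t1: "root_of_unity t1" "t1 * z = mprod r B k" by (auto simp: H_def mspan_def)
      have "\<exists>k'. mprod r B k = inverse t powi k i * mprod r B' k'"
        using mprod_exchange[OF Bnz i(1) ynz tnz y ai, of k] unfolding B'_def by blast
      then obtain k' where "t1 * z = inverse t powi k i * mprod r B' k'" using t1 by auto
      then have "t powi k i * t1 * z = mprod r B' k'"
        using tnz by (simp add: power_int_inverse field_simps)
      moreover have "root_of_unity (t powi k i * t1)"
        by (intro root_of_unity_mult root_of_unity_power_int tru t1)
      ultimately show "z \<in> H B'" unfolding H_def by (auto intro!: exI[of _ "t powi k i * t1"])
    qed
    have yH': "y \<in> H B'"
      using base_in_mspan[OF i(1), of B'] root_of_unity_1 by (auto simp: H_def B'_def intro!: exI[of _ 1])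
    have yH: "y \<notin> H B"
    proof
      assume "y \<in> H B"
      then obtain t1 c where t1: "root_of_unity t1" "t1 * y = mprod r B c" by (auto simp: H_def mspan_def)
      then have "mprod r B (\<lambda>j. int l * c j) = t1 ^ l * y ^ l"
        by (metis mprod_power power_mult_distrib)
      then have "mprod r B (\<lambda>j. int l * c j) = (t1 ^ l * t) * mprod r B a" by (simp add: y)
      moreover have "root_of_unity (t1 ^ l * t)"
        using root_of_unity_power_int[OF t1(1), of "int l"] by (intro root_of_unity_mult tru) simp
      ultimately have "int l * c i = a i" using mult_independent_unique[OF Bnz Bind] i(1) by blast
      then show False using ai prime_gt_1_nat[OF l] by (simp add: zmult_eq_1_iff)
    qed
    \<comment> \<open>The new generator lies in \<open>mspan r g\<close>; a further
      \<open>l\<close>-power removes \<eta>, so \<open>y\<close> is a radical and the covering by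
      \<open>Y\<close> applies to it.\<close>
    have "gen B' d' \<zeta>' i \<in> mspan r g"
      using base_in_mspan[OF i(1), of "gen B' d' \<zeta>'"] span' by simp
    then have "y ^ (l ^ Suc (d i)) * \<eta> \<in> mspan r g"
      by (simp add: gen_def B'_def d'_def \<zeta>'_def)
    moreover obtain k1 where "\<eta> ^ (l ^ k1) = 1" using \<open>\<eta> \<in> L\<close>
      by (auto simp: L_def)
    ultimately have "y ^ (l ^ Suc (d i) * l ^ k1) \<in> mspan r g"
      using mspan_power_int[of "y ^ (l ^ Suc (d i)) * \<eta>" r g "int (l ^ k1)"]
      by (simp only: power_int_of_nat power_mult_distrib power_mult mult_1_right)
    then have "y \<in> msat r g" using ynz l0 unfolding msat_def
      by (auto intro!: exI[of _ "l ^ Suc (d i) * l ^ k1"])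
    moreover have "\<And>h z. h \<in> mspan r g \<Longrightarrow> z \<in> H B \<Longrightarrow> h * z \<in> H B"
      by (rule H_closed[OF _ _ span]) (use Bnz \<zeta>L in auto)
    moreover have "\<And>h z. h \<in> mspan r g \<Longrightarrow> z \<in> H B' \<Longrightarrow> h * z \<in> H B'"
      by (rule H_closed[OF _ _ span']) (use B'nz \<zeta>'L in auto)
    ultimately have "card (H B \<inter> Y) < card (H B' \<inter> Y)"
      by (intro card_Int_less[OF Y gnz HH' _ _ _ yH' yH])
    then show "\<exists>s'. P s' \<and> card (H (fst s) \<inter> Y) < card (H (fst s') \<inter> Y)"
      using P' by (intro exI[of _ "(B', d', \<zeta>')"]) (simp add: s)
  qed
  then obtain B d \<zeta> where "P (B, d, \<zeta>)" "strongly_independent l r B" by auto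
  then show ?thesis unfolding P_def gen_def L_def by auto
qed

section \<open>Coset representatives of the radicals, and families of maximal length\<close>

lemma msat_covered:
  assumes nz: "\<And>i. i < r \<Longrightarrow> g i \<noteq> (0::'a::field)"
  shows "msat r g \<subseteq> {h * y | h y. h \<in> mspan r g \<and>
    y \<in> {y. \<exists>m>0. \<exists>b. (\<forall>i<r. b i < m) \<and> y ^ m = (\<Prod>i<r. g i ^ b i)}}"
proof
  fix x assume "x \<in> msat r g"
  then obtain n k where n: "n > 0" "x ^ n = mprod r g k" "x \<noteq> 0" by (auto simp: msat_def mspan_def)
  \<comment> \<open>Division of the exponents by \<open>n\<close>: the quotients form
    \<open>h\<close>, and the remainders, all below \<open>n\<close>, are the exponents of
    \<open>(x / h) ^ n\<close>.\<close>
  define h where "h = mprod r g (\<lambda>i. k i div int n)"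
  have h0: "h \<noteq> 0" unfolding h_def using nz by (rule mprod_nonzero)
  define y where "y = x / h"
  have "y ^ n = mprod r g (\<lambda>i. k i - int n * (k i div int n))"
    using nz by (simp add: y_def h_def power_divide n(2) mprod_diff mprod_scale)
  also have "\<dots> = mprod r g (\<lambda>i. int (nat (k i mod int n)))"
    using n(1) by (intro mprod_cong refl) (simp add: minus_mult_div_eq_mod)
  also have "\<dots> = (\<Prod>i<r. g i ^ nat (k i mod int n))"
    unfolding mprod_def power_int_of_nat ..
  finally have "y ^ n = (\<Prod>i<r. g i ^ nat (k i mod int n))" .
  moreover have "nat (k i mod int n) < n" for i using n(1) by (simp add: nat_less_iff)
  moreover have "x = h * y" using h0 by (simp add: y_def)
  moreover have "h \<in> mspan r g" by (simp add: h_def)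
  ultimately show "x \<in> {h * y | h y. h \<in> mspan r g \<and>
    y \<in> {y. \<exists>m>0. \<exists>b. (\<forall>i<r. b i < m) \<and> y ^ m = (\<Prod>i<r. g i ^ b i)}}"
    using n(1) by (intro CollectI exI[of _ h] exI[of _ y] exI[of _ n] exI[of _ "\<lambda>i. nat (k i mod int n)"] conjI) auto
qed

text \<open>A finite supremum is attained. Adjoining \<open>x\<close> to a family of maximal length
  creates a relation, in which the exponent of \<open>x\<close> is nonzero by independence, so that
  a power of \<open>x\<close> falls into the span.\<close>

lemma mult_rank_basis:
  assumes "mult_rank G = enat r" "(0::'a::field) \<notin> G"
  obtains g where "\<And>i. i < r \<Longrightarrow> g i \<in> G" "mult_independent r g"
    "G \<subseteq> msat r g"
proof -
  define S where "S = {enat n | n. \<exists>g. (\<forall>i<n. g i \<in> G) \<and> mult_independent n g}"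
  have Sup: "Sup S = enat r" using assms(1) by (simp add: mult_rank_def S_def)
  \<comment> \<open>The empty family keeps the set nonempty, so that its supremum is a
    maximum.\<close>
  have ne: "enat 0 \<in> S" by (auto simp: S_def mult_independent_def)
  then have "finite S" "Max S = enat r" using Sup by (auto simp: Sup_enat_def split: if_splits)
  then have "enat r \<in> S" using ne Max_in by (metis empty_iff)
  then obtain g where g: "\<And>i. i < r \<Longrightarrow> g i \<in> G" "mult_independent r g"
    by (auto simp: S_def)
  have gnz: "g i \<noteq> 0" if "i < r" for i using g(1)[OF that] assms(2) by metis
  have "x \<in> msat r g" if x: "x \<in> G" for x
  proof -
    have x0: "x \<noteq> 0" using x assms(2) by metis
    have "enat (Suc r) \<notin> S"
    proof
      assume "enat (Suc r) \<in> S"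
      then have "enat (Suc r) \<le> enat r" using Sup by (metis Sup_upper)
      then show False by simp
    qed
    moreover have "\<forall>i<Suc r. (g(r := x)) i \<in> G" using g(1) x by (auto simp: less_Suc_eq)
    ultimately have "\<not> mult_independent (Suc r) (g(r := x))" unfolding S_def by blast
    then obtain k j where k: "(\<Prod>i<Suc r. (g(r := x)) i powi k i) = 1" "j < Suc r" "k j \<noteq> 0"
      by (auto simp: mult_independent_def)
    have rel: "mprod r g k * x powi k r = 1" using k(1) by (simp add: mprod_def)
    have kr: "k r \<noteq> 0"
    proof
      assume "k r = 0"
      then have "(\<Prod>i<r. g i powi k i) = 1" using rel by (simp add: mprod_def)
      then have "\<forall>i<r. k i = 0" using g(2) unfolding mult_independent_def by blast
      then show False using k(2,3) \<open>k r = 0\<close> by (auto simp: less_Suc_eq)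
    qed
    have "x powi k r = inverse (mprod r g k)" using rel by (metis inverse_unique)
    then have mem: "x powi k r \<in> mspan r g" by (simp add: mspan_inverse)
    have "x ^ nat \<bar>k r\<bar> \<in> mspan r g"
    proof (cases "k r > 0")
      case True
      then show ?thesis using mem by (simp add: power_int_def)
    next
      case False
      then show ?thesis using mspan_inverse[OF mem] kr by (simp add: power_int_def power_inverse)
    qed
    then show ?thesis using x0 kr unfolding msat_def by (auto intro!: exI[of _ "nat \<bar>k r\<bar>"])
  qed
  then show ?thesis using that[of g] g by blast
qed

theorem theorem3p3:
  fixes G :: "'a::field_char_0 set" and l r :: nat
  assumes "number_field TYPE('a)"
    and "prime l"
    and "subgroup G unit_group"
    and "torsion_free G"
    and "mult_rank G = enat r"
    and "r > 0"
  shows "\<exists>d h :: nat \<Rightarrow> nat. \<exists>B \<zeta> :: nat \<Rightarrow> 'a.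
    strongly_independent l r B \<and>
    (\<forall>i<r. \<zeta> i \<noteq> 0 \<and> unit_ord (\<zeta> i) = l ^ h i) \<and>
    G = generate unit_group ((\<lambda>i. B i ^ (l ^ d i) * \<zeta> i) ` {..<r})"
proof -
  note G = assms(3)
  have nzG: "0 \<notin> G" using subgroup.subset[OF G] unfolding unit_group_simps by auto
  have one: "1 \<in> G" using subgroup.one_closed[OF G] unfolding unit_group_simps .
  have mult: "x * y \<in> G" if "x \<in> G" "y \<in> G" for x y
    using subgroup.m_closed[OF G that] unfolding unit_group_simps .
  have inv: "inverse x \<in> G" if "x \<in> G" for x
    using subgroup.m_inv_closed[OF G that] inv_unit_group[of x] nzG that by metis
  have "x ^ n \<in> G" if "x \<in> G" for x n using that by (induction n) (auto intro: one mult)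
  then have pow: "x powi c \<in> G" if "x \<in> G" for x c
    using that inv by (simp add: power_int_def)
  obtain g0 where g0: "\<And>i. i < r \<Longrightarrow> g0 i \<in> G" "mult_independent r g0"
    "G \<subseteq> msat r g0"
    using mult_rank_basis[OF assms(5) nzG] by metis
  have "g0 i \<noteq> 0" if "i < r" for i using g0(1)[OF that] nzG by metis
  note cover0 = msat_covered[of r g0, OF this]
  obtain g where g: "\<And>i. i < r \<Longrightarrow> g i \<in> G" "mult_independent r g" "mspan r g = G"
    using free_basis[OF finite_bounded_radicals[OF assms(1)] cover0 one mult pow nzG assms(4) g0] by blast
  have gnz: "g i \<noteq> 0" if "i < r" for i using g(1)[OF that] nzG by metis
  \<comment> \<open>The second chain starts from the basis \<open>g\<close> of \<open>G\<close>,
    with coset representatives taken for \<open>g\<close> itself.\<close>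
  obtain B d \<zeta> where B: "strongly_independent l r B" and \<zeta>:
    "\<And>i. i < r \<Longrightarrow> \<exists>k. \<zeta> i ^ (l ^ k) = 1"
    and span: "mspan r (\<lambda>i. B i ^ (l ^ d i) * \<zeta> i) = mspan r g"
    using strongly_independent_generators[OF finite_bounded_radicals[OF assms(1)] msat_covered[OF gnz] gnz g(2) assms(2)]
    by metis
  have \<zeta>0: "\<zeta> i \<noteq> 0" if "i < r" for i
    using \<zeta>[OF that] prime_gt_0_nat[OF assms(2)] by (auto simp: power_0_left)
  have "\<forall>i. \<exists>h. i < r \<longrightarrow> unit_ord (\<zeta> i) = l ^ h"
    using \<zeta> unit_ord_eq_prime_power[OF assms(2)] by blast
  then obtain h where h: "\<And>i. i < r \<Longrightarrow> unit_ord (\<zeta> i) = l ^ h i" by metis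
  have "B i ^ (l ^ d i) * \<zeta> i \<noteq> 0" if "i < r" for i
    using B \<zeta>0[OF that] that by (simp add: strongly_independent_def)
  then have "generate unit_group ((\<lambda>i. B i ^ (l ^ d i) * \<zeta> i) ` {..<r}) = G"
    using generate_eq_mspan[of r "\<lambda>i. B i ^ (l ^ d i) * \<zeta> i"] span g(3) by simp
  then show ?thesis using B \<zeta>0 h by metis
qed

end
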